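(* Let $n\ge4$ be even and let $F$ be a field of characteristic $\neq2$. Let $L=L_{n+1}$ be the simple $(n+1)$-dimensional $n$-Lie algebra over $F$ with basis $e_1,\dots,e_{n+1}$ and $[e_1,\dots,\widehat{e}_i,\dots,e_{n+1}]=(-1)^{n+i+1}e_i$ for $1\le i\le n+1$. Then the universal associative enveloping algebra $U(L)=F\langle x_1,\dots,x_{n+1}\rangle/I$ is infinite-dimensional, and a basis of $U(L)$ consists of the (cosets of the) monomials in $x_1,\dots,x_{n+1}$ which do not contain any factor of the form $x_{i_1}\cdots x_{i_n}$ with $i_1>\cdots>i_n$.
   Context: An $n$-Lie algebra is a vector space over a field of characteristic $\neq2$ with a multilinear alternating operation $[z_1,\dots,z_n]$ (permuting arguments by $\sigma$ multiplies by the sign $\epsilon(\sigma)$) satisfying $[[z_1,\dots,z_n],w_2,\dots,w_n]=\sum_{i=1}^n[z_1,\dots,[z_i,w_2,\dots,w_n],\dots,z_n]$. A hat means the entry is omitted. $\mathrm{alt}(z_1,\dots,z_n)=\sum_{\sigma\in S_n}\epsilon(\sigma)z_{\sigma(1)}\cdots z_{\sigma(n)}$. A monomial is a word in $x_1,\dots,x_{n+1}$ (including the empty word); a word $u$ is a factor of $v$ if $v=w_1uw_2$ for some words $w_1,w_2$. Universal associative envelope: let $I$ be the two-sided ideal of the free unital associative algebra $F\langle x_1,\dots,x_{n+1}\rangle$ generated by the elements $$G_i=(-1)^{\lfloor n/2\rfloor}\big(\mathrm{alt}(x_1,\dots,\widehat{x}_i,\dots,x_{n+1})-(-1)^{n+i+1}x_i\big),\quad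 1\le i\le n+1.$$ Then $U(L)=F\langle x_1,\dots,x_{n+1}\rangle/I$, with natural linear map $i\colon L\to U(L)$, $e_k\mapsto x_k+I$; it is universal among linear maps $j\colon L\to A$ to unital associative algebras with $j([z_1,\dots,z_n])=\mathrm{alt}(j(z_1),\dots,j(z_n))$. *)

theory Defs
  imports
    "HOL-Algebra.Algebra"
    "HOL-Library.Poly_Mapping"
    "HOL-Library.Sublist"
    "HOL-Combinatorics.Combinatorics"
begin

section \<open>n-Lie algebras\<close>

text \<open>
  The operation \<open>br\<close> takes its \<open>n\<close> arguments as a list; its values on lists of other
  lengths are irrelevant.
\<close>

locale n_Lie_algebra = vector_space scale
  for scale :: "'f::field \<Rightarrow> 'v::ab_group_add \<Rightarrow> 'v" +
  fixes n :: nat and br :: "'v list \<Rightarrow> 'v"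
  assumes multilinear:
      "\<And>zs i. length zs = n \<Longrightarrow> i < n \<Longrightarrow>
         Vector_Spaces.linear scale scale (\<lambda>v. br (zs[i := v]))"
    and alternating:
      "\<And>zs \<sigma>. length zs = n \<Longrightarrow> \<sigma> permutes {..<n} \<Longrightarrow>
         br (permute_list \<sigma> zs) = scale (of_int (sign \<sigma>)) (br zs)"
    and derivation:
      "\<And>zs ws. length zs = n \<Longrightarrow> length ws = n - 1 \<Longrightarrow>
         br (br zs # ws) = (\<Sum>i<n. br (zs[i := br (zs ! i # ws)]))"
begin

definition lie_ideal :: "'v set \<Rightarrow> bool" where
  "lie_ideal J \<longleftrightarrow> subspace J \<and>
     (\<forall>zs i. length zs = n \<longrightarrow> i < n \<longrightarrow> zs ! i \<in> J \<longrightarrow> br zs \<in> J)"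

definition simple :: bool where
  "simple \<longleftrightarrow> (\<exists>zs. length zs = n \<and> br zs \<noteq> 0) \<and>
     (\<forall>J. lie_ideal J \<longrightarrow> J = {0} \<or> J = UNIV)"

text \<open>\<open>e 1, \<dots>, e m\<close> is an (ordered) basis; the values of \<open>e\<close> at other indices are irrelevant.\<close>

definition ordered_basis :: "nat \<Rightarrow> (nat \<Rightarrow> 'v) \<Rightarrow> bool" where
  "ordered_basis m e \<longleftrightarrow>
     inj_on e {1..m} \<and> independent (e ` {1..m}) \<and> span (e ` {1..m}) = UNIV"

end

text \<open>The index list \<open>1, \<dots>, i-1, i+1, \<dots>, n+1\<close>.\<close>

definition omit :: "nat \<Rightarrow> nat \<Rightarrow> nat list" where
  "omit n i = filter (\<lambda>k. k \<noteq> i) [1..<n + 2]"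


section \<open>The free associative algebra\<close>

text \<open>
  Words form a monoid under concatenation. It is written additively because the product on
  the finitely supported functions \<open>'a \<Rightarrow>\<^sub>0 'b\<close> is convolution with respect to addition of
  \<open>'a\<close>. Thus \<open>nat list \<Rightarrow>\<^sub>0 'f\<close> is the free unital associative algebra on the letters
  \<open>x\<^sub>k\<close> (\<open>k :: nat\<close>), and \<open>Poly_Mapping.single w c\<close> is \<open>c\<close> times the monomial \<open>w\<close>.
\<close>

instantiation list :: (type) monoid_add
begin

definition zero_list :: "'a list" where "zero_list = []"
definition plus_list :: "'a list \<Rightarrow> 'a list \<Rightarrow> 'a list" where "plus_list u v = u @ v"

instance by standard (simp_all add: zero_list_def plus_list_def)

end

type_synonym 'f noncomm_poly = "nat list \<Rightarrow>\<^sub>0 'f"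

definition const :: "'f::field \<Rightarrow> 'f noncomm_poly" where
  "const c = Poly_Mapping.single [] c"

definition monomial :: "nat list \<Rightarrow> 'f::field noncomm_poly" where
  "monomial w = Poly_Mapping.single w 1"

abbreviation gen :: "nat \<Rightarrow> 'f::field noncomm_poly" where
  "gen k \<equiv> monomial [k]"

definition free_algebra :: "nat set \<Rightarrow> 'f::field noncomm_poly ring" where
  "free_algebra A = \<lparr>carrier = {p. Poly_Mapping.keys p \<subseteq> lists A},
     monoid.mult = (*), one = 1, ring.zero = 0, add = (+)\<rparr>"

definition alt :: "'a::ring_1 list \<Rightarrow> 'a" where
  "alt zs = (\<Sum>\<sigma> | \<sigma> permutes {..<length zs}.
     of_int (sign \<sigma>) * prod_list (permute_list \<sigma> zs))"

lemma monomial_eq_prod_list: "monomial w = (prod_list (map gen w) :: 'f::field noncomm_poly)"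
proof (induction w)
  case Nil
  show ?case by (simp add: monomial_def zero_list_def flip: single_one)
next
  case (Cons k w)
  have "gen k * monomial w = (monomial (k # w) :: 'f noncomm_poly)"
    by (simp add: monomial_def mult_single plus_list_def)
  then show ?case using Cons by simp
qed

lemma ring_free_algebra: "ring (free_algebra A :: 'f::field noncomm_poly ring)"
proof (rule ringI)
  let ?R = "free_algebra A :: 'f noncomm_poly ring"
  show "abelian_group ?R"
  proof (rule abelian_groupI)
    fix p q assume "p \<in> carrier ?R" "q \<in> carrier ?R"
    then show "p \<oplus>\<^bsub>?R\<^esub> q \<in> carrier ?R"
      using keys_add[of p q] by (auto simp: free_algebra_def)
  next
    fix p assume "p \<in> carrier ?R"
    then show "\<exists>q\<in>carrier ?R. q \<oplus>\<^bsub>?R\<^esub> p = \<zero>\<^bsub>?R\<^esub>"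
      by (intro bexI[of _ "- p"]) (auto simp: free_algebra_def)
  qed (auto simp: free_algebra_def algebra_simps)
  show "monoid ?R"
  proof (rule monoidI)
    fix p q assume "p \<in> carrier ?R" "q \<in> carrier ?R"
    then show "p \<otimes>\<^bsub>?R\<^esub> q \<in> carrier ?R"
      using keys_mult[of p q] by (fastforce simp: free_algebra_def plus_list_def)
  qed (auto simp: free_algebra_def zero_list_def algebra_simps)
qed (auto simp: free_algebra_def algebra_simps)


section \<open>The universal associative envelope\<close>

context n_Lie_algebra
begin

text \<open>The linear map from the algebra into the free algebra with \<open>e k \<mapsto> x\<^sub>k\<close>.\<close>

definition lift :: "(nat \<Rightarrow> 'v) \<Rightarrow> 'v \<Rightarrow> 'f noncomm_poly" where
  "lift e v = (\<Sum>k = 1..n + 1. const (representation (e ` {1..n + 1}) v (e k)) * gen k)"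

text \<open>
  The relations identifying \<open>[e\<^sub>1, \<dots>, e\<^sub>i\<^sub>-\<^sub>1, e\<^sub>i\<^sub>+\<^sub>1, \<dots>, e\<^sub>n\<^sub>+\<^sub>1]\<close> with the alternating sum, for an
  \<open>(n+1)\<close>-dimensional \<open>n\<close>-Lie algebra with basis \<open>e\<close>. The sign in front is that of the reversal
  of \<open>n\<close> letters, so that the decreasing word has coefficient 1. The lemma
  \<open>env_relation_eq\<close> below gives the explicit form for the algebra \<open>L\<^sub>n\<^sub>+\<^sub>1\<close>.
\<close>

definition env_relation :: "(nat \<Rightarrow> 'v) \<Rightarrow> nat \<Rightarrow> 'f noncomm_poly" where
  "env_relation e i =
     (- 1) ^ (n div 2) * (alt (map gen (omit n i)) - lift e (br (map e (omit n i))))"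

definition env_ideal :: "(nat \<Rightarrow> 'v) \<Rightarrow> 'f noncomm_poly set" where
  "env_ideal e = genideal (free_algebra {1..n + 1}) (env_relation e ` {1..n + 1})"

definition envelope :: "(nat \<Rightarrow> 'v) \<Rightarrow> 'f noncomm_poly set ring" where
  "envelope e = free_algebra {1..n + 1} Quot env_ideal e"

definition env_coset :: "(nat \<Rightarrow> 'v) \<Rightarrow> 'f noncomm_poly \<Rightarrow> 'f noncomm_poly set" where
  "env_coset e p = env_ideal e +>\<^bsub>free_algebra {1..n + 1}\<^esub> p"

text \<open>The copy \<open>F \<cdot> 1\<close> of the ground field, through which \<open>F\<close> acts on the envelope.\<close>

definition env_scalars :: "(nat \<Rightarrow> 'v) \<Rightarrow> 'f noncomm_poly set set" where
  "env_scalars e = range (\<lambda>c. env_coset e (const c))"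

lemma env_relation_eq:
  assumes "ordered_basis (n + 1) e" and i: "i \<in> {1..n + 1}"
    and br: "br (map e (omit n i)) = scale ((- 1) ^ (n + i + 1)) (e i)"
  shows "env_relation e i =
    (- 1) ^ (n div 2) * (alt (map gen (omit n i)) - (- 1) ^ (n + i + 1) * gen i)"
proof -
  let ?B = "e ` {1..n + 1}"
  have inj: "inj_on e {1..n + 1}" and ind: "independent ?B" and sp: "span ?B = UNIV"
    using assms by (auto simp: ordered_basis_def)
  have "representation ?B (scale c (e i)) (e k) = (if k = i then c else 0)"
    if "k \<in> {1..n + 1}" for c k
  proof -
    have "representation ?B (e i) = (\<lambda>v. if v = e i then 1 else 0)"
      using representation_basis[OF ind] i by blast
    moreover have "e k = e i \<longleftrightarrow> k = i"
      using inj that i by (auto dest: inj_onD)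
    ultimately show ?thesis
      using representation_scale[OF ind, of "e i" c] sp by simp
  qed
  then have "lift e (scale c (e i)) = (\<Sum>k = 1..n + 1. if k = i then const c * gen k else 0)" for c
    unfolding lift_def by (intro sum.cong) (auto simp: const_def)
  then have "lift e (scale c (e i)) = const c * gen i" for c
    using i by simp
  moreover have "const ((- 1) ^ m) = ((- 1) ^ m :: 'f noncomm_poly)" for m
  proof -
    have "const 1 = (1 :: 'f noncomm_poly)"
      by (simp add: const_def zero_list_def flip: single_one)
    moreover from this have "const (- 1) = (- 1 :: 'f noncomm_poly)"
      by (simp add: const_def single_uminus)
    ultimately show ?thesis
      by (cases "even m") simp_all
  qed
  ultimately show ?thesis
    by (simp only: env_relation_def br)
qed

end


section \<open>Bases over a subfield\<close>

text \<open>
  The library notions \<open>ring.independent\<close> and \<open>ring.Span\<close> are for finite lists of vectors; this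
  is the usual extension to possibly infinite sets.
\<close>

definition is_basis :: "('a, 'b) ring_scheme \<Rightarrow> 'a set \<Rightarrow> 'a set \<Rightarrow> bool" where
  "is_basis R K B \<longleftrightarrow> B \<subseteq> carrier R \<and>
     (\<forall>us. distinct us \<longrightarrow> set us \<subseteq> B \<longrightarrow> ring.independent R K us) \<and>
     (\<forall>v\<in>carrier R. \<exists>us. set us \<subseteq> B \<and> v \<in> ring.Span R K us)"


section \<open>Normal words\<close>

definition normal_words :: "nat \<Rightarrow> nat list set" where
  "normal_words n = {w \<in> lists {1..n + 1}.
     \<not> (\<exists>u. sublist u w \<and> length u = n \<and> sorted_wrt (>) u)}"

end

theory Submission
  imports Defs "Jordan_Normal_Form.Determinant"
begin

text \<open>
  Order words first by length and then lexicographically. The relation \<open>G\<^sub>i\<close> is monic, and its leading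
  word is the decreasing word \<open>D\<^sub>i\<close> in all letters but \<open>x\<^sub>i\<close>: among the words of \<open>alt\<close> the decreasing
  one is the largest, and the remaining term \<open>x\<^sub>i\<close> is shorter. The words in the theorem are those
  without a factor \<open>D\<^sub>i\<close>, so the claim is that the \<open>G\<^sub>i\<close> are a (noncommutative) Groebner basis of the
  ideal. The diamond lemma reduces this to the overlaps of leading words.

  If a nonempty proper suffix of \<open>D\<^sub>i\<close> is a prefix of \<open>D\<^sub>j\<close>, then gluing the two words along it gives a
  decreasing word with more than \<open>n\<close> letters. It must be \<open>x\<^sub>n\<^sub>+\<^sub>1 \<cdots> x\<^sub>1\<close>, and then \<open>i = 1\<close> and
  \<open>j = n + 1\<close> (lemma \<open>overlap_of_leading_words\<close>). Hence there is just one composition to resolve,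
  \<open>G\<^sub>1 x\<^sub>1 - x\<^sub>n\<^sub>+\<^sub>1 G\<^sub>n\<^sub>+\<^sub>1\<close>. Expanding \<open>alt(x\<^sub>1, \<dots>, x\<^sub>n\<^sub>+\<^sub>1)\<close> along the first and along the last
  factor of its products gives two sums, with terms \<open>x\<^sub>i alt(\<dots>)\<close> and \<open>alt(\<dots>) x\<^sub>i\<close>. Their signs agree
  because \<open>n\<close> is even. The correction terms of \<open>x\<^sub>i G\<^sub>i\<close> and \<open>G\<^sub>i x\<^sub>i\<close> are both multiples of \<open>x\<^sub>i x\<^sub>i\<close>
  and cancel, so \<open>\<Sum>\<^sub>i (-1)\<^sup>i (x\<^sub>i G\<^sub>i - G\<^sub>i x\<^sub>i) = 0\<close> (lemma \<open>alt_relation_syzygy\<close>). Solved for the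
  composition, this expresses it by products \<open>x\<^sub>i G\<^sub>i\<close> and \<open>G\<^sub>i x\<^sub>i\<close> whose leading words are all
  smaller than \<open>x\<^sub>n\<^sub>+\<^sub>1 \<cdots> x\<^sub>1\<close>, which is what the diamond lemma asks for.

  The diamond lemma itself is proved by linear algebra. For each reducible word choose one multiple
  \<open>u G\<^sub>i v\<close> that has it as its leading word. The chosen multiples together with the irreducible words
  form a triangular system, so no nonzero combination of chosen multiples is a combination of
  irreducible words (theorem \<open>span_multiples_inter_normal\<close>). Since overlaps resolve, two multiples
  with the same leading word differ by multiples with smaller leading words, and by induction the
  chosen ones span the ideal.

  The quotient has infinite dimension because all powers of \<open>x\<^sub>1\<close> are irreducible.
\<close>


section \<open>The free algebra as a vector space\<close>

lemma const_mult_commute: "const c * p = p * const (c :: 'f::field)"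
proof (induction p rule: update_induct)
  case const
  then show ?case by simp
next
  case (update f a b)
  have "Poly_Mapping.update a b f = Poly_Mapping.single a b + f"
    using update by (intro poly_mapping_eqI)
      (auto simp: lookup_update lookup_add lookup_single in_keys_iff when_def)
  then show ?case using update
    by (simp add: distrib_left distrib_right const_def mult_single plus_list_def mult.commute)
qed

lemma lookup_const_mult: "Poly_Mapping.lookup (const c * p) w = (c::'f::field) * Poly_Mapping.lookup p w"
  unfolding const_def zero_list_def[symmetric] mult_map_scale_conv_mult[symmetric]
  by (simp add: Poly_Mapping.map.rep_eq when_def)

interpretation words: vector_space "\<lambda>c p. const c * (p :: 'f::field noncomm_poly)"
  by standard (auto intro!: poly_mapping_eqI simp: lookup_const_mult lookup_add algebra_simps)

lemma monomial_mult: "monomial u * monomial v = (monomial (u @ v) :: 'f::field noncomm_poly)"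
  by (simp add: monomial_def mult_single plus_list_def)

lemma monomial_Nil: "monomial [] = (1 :: 'f::field noncomm_poly)"
  by (simp add: monomial_def zero_list_def flip: single_one)

lemma lookup_monomial: "Poly_Mapping.lookup (monomial u :: 'f::field noncomm_poly) w = (if w = u then 1 else 0)"
  by (simp add: monomial_def lookup_single when_def)

lemma span_monomials: "words.span (monomial ` W) = {p :: 'f::field noncomm_poly. Poly_Mapping.keys p \<subseteq> W}"
proof (intro equalityI subsetI; simp)
  fix p :: "'f noncomm_poly"
  assume "p \<in> words.span (monomial ` W)"
  then show "Poly_Mapping.keys p \<subseteq> W"
  proof (induction rule: words.span_induct_alt)
    case base
    then show ?case by simp
  next
    case (step c x y)
    then show ?case
      by (auto simp: in_keys_iff lookup_add lookup_const_mult lookup_monomial split: if_splits)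
  qed
next
  fix p :: "'f noncomm_poly"
  assume *: "Poly_Mapping.keys p \<subseteq> W"
  have "p = (\<Sum>w\<in>Poly_Mapping.keys p. const (Poly_Mapping.lookup p w) * monomial w)"
    by (intro poly_mapping_eqI)
      (auto simp: lookup_sum lookup_const_mult lookup_monomial in_keys_iff if_distrib cong: if_cong)
  also have "\<dots> \<in> words.span (monomial ` W)"
    using * by (intro words.span_sum words.span_scale words.span_base) auto
  finally show "p \<in> words.span (monomial ` W)" .
qed

lemma carrier_free_algebra:
  "carrier (free_algebra A :: 'f::field noncomm_poly ring) = words.span (monomial ` lists A)"
  by (simp add: free_algebra_def span_monomials)

text \<open>
  Linear maps of the form \<open>p \<mapsto> l p r\<close> may be checked on a spanning set. All memberships in spaces
  of relations below are obtained in this way.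
\<close>

lemma span_mult_subset:
  fixes p :: "'f::field noncomm_poly"
  assumes "p \<in> words.span B" and "\<And>b. b \<in> B \<Longrightarrow> l * b * r \<in> words.span C"
  shows "l * p * r \<in> words.span C"
  using assms(1)
proof (induction rule: words.span_induct_alt)
  case base
  then show ?case by (simp add: words.span_zero)
next
  case (step c x y)
  have "l * (const c * x + y) * r = const c * (l * x * r) + l * y * r"
    using const_mult_commute[of c l] by (simp add: algebra_simps flip: mult.assoc)
  then show ?case using step assms(2) by (simp add: words.span_add words.span_scale)
qed


section \<open>The diamond lemma\<close>

text \<open>
  The degree-lexicographic order is well-founded, and it is compatible with multiplication of words
  on both sides.
\<close>

abbreviation deglex :: "nat list \<Rightarrow> nat list \<Rightarrow> bool" (infix "\<lless>" 50) where
  "u \<lless> v \<equiv> (u, v) \<in> lenlex less_than"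

lemma deglex_trans: "u \<lless> v \<Longrightarrow> v \<lless> w \<Longrightarrow> u \<lless> w"
  by (rule lenlex_trans[OF _ _ trans_less_than])

lemma deglex_irrefl: "\<not> u \<lless> u"
  by (rule lenlex_irreflexive) simp

lemma deglex_context: "m \<lless> m' \<Longrightarrow> u @ m @ v \<lless> u @ m' @ v"
  by (simp add: lenlex_append1 lenlex_append2[OF irrefl_less_than] del: append_assoc)

lemma deglex_maximal:
  assumes "finite W" "W \<noteq> {}"
  obtains w where "w \<in> W" and "\<And>v. v \<in> W \<Longrightarrow> v = w \<or> v \<lless> w"
proof -
  have "\<exists>w\<in>W. \<forall>v\<in>W. v = w \<or> v \<lless> w"
    using assms
  proof (induction rule: finite_ne_induct)
    case (singleton w)
    then show ?case by simp
  next
    case (insert x W)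
    then obtain w where "w \<in> W" "\<forall>v\<in>W. v = w \<or> v \<lless> w" by blast
    moreover have "x = w \<or> x \<lless> w \<or> w \<lless> x"
      using total_lenlex[OF total_less_than] by (auto simp: total_on_def)
    ultimately show ?case
      by (metis deglex_trans insert_iff)
  qed
  then show ?thesis using that by blast
qed

text \<open>
  The condition \<open>tail\<close> says at once that \<open>lead i\<close> is the leading word of \<open>g i\<close>, that its
  coefficient is 1, and that \<open>g i\<close> lies in the free algebra on \<open>A\<close>.
\<close>

locale monic_relations =
  fixes A :: "nat set" and J :: "'i set" and lead :: "'i \<Rightarrow> nat list"
    and g :: "'i \<Rightarrow> 'f::field noncomm_poly"
  assumes lead_in: "i \<in> J \<Longrightarrow> lead i \<in> lists A"
    and tail: "i \<in> J \<Longrightarrow>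
      monomial (lead i) - g i \<in> words.span (monomial ` {m \<in> lists A. m \<lless> lead i})"
begin

text \<open>
  The predicate \<open>P\<close> is a condition on the leading word of the multiple \<open>u g\<^sub>i v\<close>. It is instantiated
  with all words, with a single word, and with the words below a given one.
\<close>

definition multiples :: "(nat list \<Rightarrow> bool) \<Rightarrow> 'f noncomm_poly set" where
  "multiples P = {monomial u * g i * monomial v | u i v.
     i \<in> J \<and> u \<in> lists A \<and> v \<in> lists A \<and> P (u @ lead i @ v)}"

abbreviation relations_below :: "nat list \<Rightarrow> 'f noncomm_poly set" where
  "relations_below w \<equiv> words.span (multiples (\<lambda>w'. w' \<lless> w))"

definition reducible :: "nat list set" where
  "reducible = {u @ lead i @ v | u i v. i \<in> J \<and> u \<in> lists A \<and> v \<in> lists A}"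

lemma multiplesI:
  "i \<in> J \<Longrightarrow> u \<in> lists A \<Longrightarrow> v \<in> lists A \<Longrightarrow> P (u @ lead i @ v) \<Longrightarrow>
    monomial u * g i * monomial v \<in> multiples P"
  unfolding multiples_def by blast

lemma relations_below_context:
  assumes "p \<in> relations_below w" "u \<in> lists A" "v \<in> lists A"
  shows "monomial u * p * monomial v \<in> relations_below (u @ w @ v)"
  using assms(1)
proof (rule span_mult_subset)
  fix b assume "b \<in> multiples (\<lambda>w'. w' \<lless> w)"
  then obtain u' i v' where b: "b = monomial u' * g i * monomial v'" "i \<in> J"
    "u' \<in> lists A" "v' \<in> lists A" "u' @ lead i @ v' \<lless> w"
    unfolding multiples_def by blast
  have "monomial u * b * monomial v = monomial (u @ u') * g i * monomial (v' @ v)"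
    by (simp add: b mult.assoc flip: monomial_mult)
  also have "\<dots> \<in> multiples (\<lambda>w'. w' \<lless> u @ w @ v)"
    using b assms deglex_context[OF b(5), of u v] by (intro multiplesI) auto
  finally show "monomial u * b * monomial v \<in> relations_below (u @ w @ v)"
    by (rule words.span_base)
qed

lemma tail_context:
  assumes "i \<in> J" "u \<in> lists A" "v \<in> lists A"
  shows "monomial (u @ lead i @ v) - monomial u * g i * monomial v \<in>
    words.span (monomial ` {m \<in> lists A. m \<lless> u @ lead i @ v})"
proof -
  have "monomial u * (monomial (lead i) - g i) * monomial v \<in>
    words.span (monomial ` {m \<in> lists A. m \<lless> u @ lead i @ v})"
    using tail[OF assms(1)]
  proof (rule span_mult_subset)
    fix b :: "'f noncomm_poly" assume "b \<in> monomial ` {m \<in> lists A. m \<lless> lead i}"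
    then obtain m where m: "b = monomial m" "m \<in> lists A" "m \<lless> lead i" by blast
    then show "monomial u * b * monomial v \<in> words.span (monomial ` {m \<in> lists A. m \<lless> u @ lead i @ v})"
      using assms deglex_context[OF m(3), of u v]
      by (intro words.span_base) (auto simp: monomial_mult)
  qed
  then show ?thesis
    by (simp add: algebra_simps monomial_mult)
qed

text \<open>
  When two leading words occur in \<open>w\<close> without overlap, rewriting one does not disturb the other: with
  \<open>g\<^sub>i = D\<^sub>i - l\<^sub>i\<close>, the two multiples with leading word \<open>u D\<^sub>i z D\<^sub>j v\<close> differ by
  \<open>u g\<^sub>i z l\<^sub>j v - u l\<^sub>i z g\<^sub>j v\<close>, and all words in the tails \<open>l\<^sub>i\<close> and \<open>l\<^sub>j\<close> are smaller than \<open>D\<^sub>i\<close> and \<open>D\<^sub>j\<close>.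
\<close>

lemma disjoint_occurrences:
  assumes i: "i \<in> J" and j: "j \<in> J" and A: "u \<in> lists A" "z \<in> lists A" "v \<in> lists A"
  shows "monomial u * g i * monomial (z @ lead j @ v) - monomial (u @ lead i @ z) * g j * monomial v
    \<in> relations_below (u @ lead i @ z @ lead j @ v)"
proof -
  let ?w = "u @ lead i @ z @ lead j @ v"
  have "(monomial u * g i * monomial z) * (monomial (lead j) - g j) * monomial v \<in> relations_below ?w"
    using tail[OF j]
  proof (rule span_mult_subset)
    fix b :: "'f noncomm_poly" assume "b \<in> monomial ` {m \<in> lists A. m \<lless> lead j}"
    then obtain m where m: "b = monomial m" "m \<in> lists A" "m \<lless> lead j" by blast
    have "monomial u * g i * monomial (z @ m @ v) \<in> multiples (\<lambda>w. w \<lless> ?w)"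
      using A i m deglex_context[OF m(3), of "u @ lead i @ z" v] by (intro multiplesI) auto
    then show "(monomial u * g i * monomial z) * b * monomial v \<in> relations_below ?w"
      by (simp add: m mult.assoc words.span_base flip: monomial_mult)
  qed
  moreover have "monomial u * (monomial (lead i) - g i) * (monomial z * g j * monomial v) \<in> relations_below ?w"
    using tail[OF i]
  proof (rule span_mult_subset)
    fix b :: "'f noncomm_poly" assume "b \<in> monomial ` {m \<in> lists A. m \<lless> lead i}"
    then obtain m where m: "b = monomial m" "m \<in> lists A" "m \<lless> lead i" by blast
    have "monomial (u @ m @ z) * g j * monomial v \<in> multiples (\<lambda>w. w \<lless> ?w)"
      using A j m deglex_context[OF m(3), of u "z @ lead j @ v"] by (intro multiplesI) auto
    then show "monomial u * b * (monomial z * g j * monomial v) \<in> relations_below ?w"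
      by (simp add: m mult.assoc words.span_base flip: monomial_mult)
  qed
  ultimately have "(monomial u * g i * monomial z) * (monomial (lead j) - g j) * monomial v -
      monomial u * (monomial (lead i) - g i) * (monomial z * g j * monomial v) \<in> relations_below ?w"
    by (rule words.span_diff)
  then show ?thesis
    by (simp add: algebra_simps flip: monomial_mult)
qed

end

text \<open>
  The hypotheses of the diamond lemma. The first one excludes inclusion ambiguities. In the second
  one, the composition of an overlap \<open>a b c\<close> lies in the span of the multiples with leading word below
  \<open>a b c\<close>.
\<close>

locale groebner_basis = monic_relations A J lead g
  for A and J :: "'i set" and lead and g :: "'i \<Rightarrow> 'f::field noncomm_poly" +
  assumes no_inclusion: "\<lbrakk>i \<in> J; j \<in> J; lead i = u @ lead j @ v\<rbrakk> \<Longrightarrow> i = j \<and> u = [] \<and> v = []"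
    and resolvable: "\<lbrakk>i \<in> J; j \<in> J; lead i = a @ b; lead j = b @ c; a \<noteq> []; b \<noteq> []; c \<noteq> []\<rbrakk> \<Longrightarrow>
      g i * monomial c - monomial a * g j \<in> relations_below (a @ b @ c)"
begin

text \<open>
  The right one of the two occurrences either starts after the left one has ended, or is contained
  in it, or overlaps it. These cases are covered by \<open>disjoint_occurrences\<close>, \<open>no_inclusion\<close> and
  \<open>resolvable\<close>.
\<close>

lemma same_word_aux:
  assumes i: "i \<in> J" and j: "j \<in> J"
    and A: "u \<in> lists A" "v \<in> lists A" "u' \<in> lists A" "v' \<in> lists A"
    and eq: "u @ lead i @ v = u' @ lead j @ v'" and le: "length u \<le> length u'"
  shows "monomial u * g i * monomial v - monomial u' * g j * monomial v'
    \<in> relations_below (u @ lead i @ v)"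
proof -
  obtain a where u': "u' = u @ a"
    using eq le by (metis append_eq_append_conv_if append_take_drop_id)
  have eq: "lead i @ v = a @ lead j @ v'" using eq u' by simp
  consider z where "a = lead i @ z" "v = z @ lead j @ v'"
    | c where "lead i = a @ lead j @ c" "v' = c @ v" 
    | b c where "lead i = a @ b" "lead j = b @ c" "v = c @ v'" "b \<noteq> []" "c \<noteq> []"
  proof -
    consider z where "a = lead i @ z" "v = z @ lead j @ v'" | b where "lead i = a @ b" "b @ v = lead j @ v'"
      using eq unfolding append_eq_append_conv2[of "lead i"] by auto
    then show ?thesis
    proof cases
      case (2 b)
      consider c where "b = lead j @ c" "v' = c @ v" | c where "lead j = b @ c" "v = c @ v'"
        using 2(2) unfolding append_eq_append_conv2[of b] by metis
      then show ?thesis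
        using that 2 by (metis append_Nil append_Nil2)
    qed (use that in blast)
  qed
  then show ?thesis
  proof cases
    case 1
    then show ?thesis
      using disjoint_occurrences[OF i j, of u z v'] A u' by simp
  next
    case 2
    then show ?thesis
      using no_inclusion[OF i j, of a c] u' eq by (simp add: words.span_zero)
  next
    case 3
    show ?thesis
    proof (cases "a = []")
      case True
      \<comment> \<open>Both occurrences start at the same place, so one leading word contains the other.\<close>
      then show ?thesis
        using no_inclusion[OF j i, of "[]" c] 3 by simp
    next
      case False
      have "monomial u * (g i * monomial c - monomial a * g j) * monomial v'
        \<in> relations_below (u @ (a @ b @ c) @ v')"
        using resolvable[OF i j] 3 False A by (intro relations_below_context) auto
      then show ?thesis
        by (simp add: 3 u' algebra_simps flip: monomial_mult)
    qed
  qed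
qed

lemma same_word:
  assumes i: "i \<in> J" and j: "j \<in> J"
    and A: "u \<in> lists A" "v \<in> lists A" "u' \<in> lists A" "v' \<in> lists A"
    and eq: "u @ lead i @ v = u' @ lead j @ v'"
  shows "monomial u * g i * monomial v - monomial u' * g j * monomial v'
    \<in> relations_below (u @ lead i @ v)"
proof (cases "length u \<le> length u'")
  case True
  then show ?thesis using same_word_aux assms by blast
next
  case False
  then have "monomial u' * g j * monomial v' - monomial u * g i * monomial v
    \<in> relations_below (u @ lead i @ v)"
    using same_word_aux[OF j i A(3,4,1,2) eq[symmetric]] eq by simp
  from words.span_neg[OF this] show ?thesis by simp
qed

text \<open>
  One multiple of a relation for each reducible word. By \<open>same_word\<close> the choice does not matter
  modulo multiples with smaller leading words.
\<close>

definition representative :: "nat list \<Rightarrow> 'f noncomm_poly" where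
  "representative w = (SOME p. p \<in> multiples (\<lambda>w'. w' = w))"

lemma representative_in:
  assumes "w \<in> reducible"
  shows "representative w \<in> multiples (\<lambda>w'. w' = w)"
proof -
  have "\<exists>p. p \<in> multiples (\<lambda>w'. w' = w)"
    using assms multiplesI[where P = "\<lambda>w'. w' = w"] unfolding reducible_def by blast
  then show ?thesis
    unfolding representative_def by (rule someI_ex)
qed

lemma lookup_representative:
  assumes "w \<in> reducible"
  shows "Poly_Mapping.lookup (representative w) w = 1"
    and "Poly_Mapping.lookup (representative w) m \<noteq> 0 \<Longrightarrow> m = w \<or> m \<lless> w"
proof -
  have "monomial w - representative w \<in> words.span (monomial ` {m \<in> lists A. m \<lless> w})"
  proof -
    obtain u i v where uiv: "representative w = monomial u * g i * monomial v" "i \<in> J"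
      "u \<in> lists A" "v \<in> lists A" "w = u @ lead i @ v"
      using representative_in[OF assms] unfolding multiples_def by blast
    show ?thesis
      using tail_context[OF uiv(2-4)] unfolding uiv(1,5)[symmetric] .
  qed
  then have *: "Poly_Mapping.keys (monomial w - representative w) \<subseteq> {m. m \<lless> w}"
    by (auto simp: span_monomials)
  then have "w \<notin> Poly_Mapping.keys (monomial w - representative w)"
    using deglex_irrefl by blast
  then show "Poly_Mapping.lookup (representative w) w = 1"
    by (simp add: in_keys_iff lookup_minus lookup_monomial)
  show "m = w \<or> m \<lless> w" if "Poly_Mapping.lookup (representative w) m \<noteq> 0"
  proof (rule ccontr)
    assume m: "\<not> (m = w \<or> m \<lless> w)"
    then have "m \<notin> Poly_Mapping.keys (monomial w - representative w)"
      using * by blast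
    then show False
      using that m by (simp add: in_keys_iff lookup_minus lookup_monomial)
  qed
qed

lemma inj_on_representative: "inj_on representative reducible"
proof (rule inj_onI)
  fix w w' assume w: "w \<in> reducible" "w' \<in> reducible" "representative w = representative w'"
  have "w = w' \<or> w \<lless> w'" "w' = w \<or> w' \<lless> w"
    using lookup_representative w by (metis one_neq_zero)+
  then show "w = w'"
    using deglex_trans deglex_irrefl by blast
qed

lemma multiple_in_span_representatives:
  assumes "i \<in> J" "u \<in> lists A" "v \<in> lists A"
  shows "monomial u * g i * monomial v \<in> words.span (representative ` reducible)"
proof -
  have "wf (lenlex less_than)" by (rule wf_lenlex[OF wf_less_than])
  then have "p \<in> words.span (representative ` reducible)" if "p \<in> multiples (\<lambda>w'. w' = w)" for p w
    using that
  proof (induction w arbitrary: p rule: wf_induct_rule)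
    case (less w)
    then have w: "w \<in> reducible"
      unfolding multiples_def reducible_def by blast
    have "p - representative w \<in> relations_below w"
    proof -
      obtain u i v where uiv: "p = monomial u * g i * monomial v" "i \<in> J"
        "u \<in> lists A" "v \<in> lists A" "w = u @ lead i @ v"
        using less.prems unfolding multiples_def by blast
      obtain u' j v' where ujv: "representative w = monomial u' * g j * monomial v'" "j \<in> J"
        "u' \<in> lists A" "v' \<in> lists A" "w = u' @ lead j @ v'"
        using representative_in[OF w] unfolding multiples_def by blast
      show ?thesis
        using same_word[OF uiv(2) ujv(2) uiv(3,4) ujv(3,4)] uiv(1,5) ujv(1,5) by metis
    qed
    also have "\<dots> \<subseteq> words.span (representative ` reducible)"
    proof (rule words.span_minimal[OF _ words.subspace_span], rule subsetI)
      fix q assume "q \<in> multiples (\<lambda>w'. w' \<lless> w)"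
      then obtain w' where "q \<in> multiples (\<lambda>v. v = w')" "w' \<lless> w"
        unfolding multiples_def by blast
      then show "q \<in> words.span (representative ` reducible)"
        using less.IH by blast
    qed
    finally have "(p - representative w) + representative w \<in> words.span (representative ` reducible)"
      using w by (blast intro: words.span_add words.span_base)
    then show ?case by simp
  qed
  moreover have "monomial u * g i * monomial v \<in> multiples (\<lambda>w'. w' = u @ lead i @ v)"
    using assms by (intro multiplesI) auto
  ultimately show ?thesis by blast
qed

text \<open>
  In a nonzero combination of representatives, consider the largest leading word that occurs. The
  words of every other representative involved are at most its own, smaller leading word. Hence this
  reducible word does not cancel.
\<close>

theorem span_multiples_inter_normal:
  assumes f: "f \<in> words.span (multiples (\<lambda>_. True))"
    and normal: "Poly_Mapping.keys f \<inter> reducible = {}"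
  shows "f = 0"
proof (rule ccontr)
  assume nz: "f \<noteq> 0"
  have "words.span (multiples (\<lambda>_. True)) \<subseteq> words.span (representative ` reducible)"
    using multiple_in_span_representatives unfolding multiples_def
    by (intro words.span_minimal[OF _ words.subspace_span]) blast
  with f have "f \<in> words.span (representative ` reducible)" by blast
  then obtain T r where T: "f = (\<Sum>p\<in>T. const (r p) * p)" "finite T"
    "T \<subseteq> representative ` reducible"
    unfolding words.span_explicit mem_Collect_eq by (elim exE conjE) (rule that)
  obtain W where W: "W \<subseteq> reducible" "T = representative ` W"
    using T(3) by (metis subset_imageE)
  have inj: "inj_on representative W"
    using W(1) inj_on_representative inj_on_subset by blast
  then have fin: "finite W" using T(2) W(2) finite_imageD by blast
  define c where "c w = r (representative w)" for w
  have f: "f = (\<Sum>w\<in>W. const (c w) * representative w)"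
    unfolding T(1) W(2) c_def by (simp add: sum.reindex[OF inj])
  let ?W = "{w \<in> W. c w \<noteq> 0}"
  have "?W \<noteq> {}"
  proof
    assume "?W = {}"
    then have "c w = 0" if "w \<in> W" for w using that by blast
    then show False using nz f by simp
  qed
  moreover have "finite ?W" using fin by simp
  ultimately obtain w where w: "w \<in> ?W" "\<And>v. v \<in> ?W \<Longrightarrow> v = w \<or> v \<lless> w"
    using deglex_maximal by blast
  have "c v * Poly_Mapping.lookup (representative v) w = (if v = w then c w else 0)" if "v \<in> W" for v
  proof (cases "v = w \<or> c v = 0")
    case True
    then show ?thesis using lookup_representative(1)[of w] w(1) W(1) by auto
  next
    case False
    then have "v \<lless> w" using w(2)[of v] that by blast
    then have "\<not> w \<lless> v" using deglex_trans deglex_irrefl by blast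
    then show ?thesis
      using lookup_representative(2)[of v w] that W(1) False by auto
  qed
  then have "Poly_Mapping.lookup f w = (\<Sum>v\<in>W. if v = w then c w else 0)"
    unfolding f by (simp add: lookup_sum lookup_const_mult)
  also have "\<dots> = c w" using w(1) fin by simp
  finally have "w \<in> Poly_Mapping.keys f" using w(1) by (simp add: in_keys_iff)
  then show False using normal w(1) W(1) by blast
qed

end


section \<open>Bases of quotients of the free algebra\<close>

lemma free_algebra_ops [simp]:
  "x \<otimes>\<^bsub>free_algebra A\<^esub> y = x * y" "x \<oplus>\<^bsub>free_algebra A\<^esub> y = x + y"
  "\<one>\<^bsub>free_algebra A\<^esub> = 1" "\<zero>\<^bsub>free_algebra A\<^esub> = (0 :: 'f::field noncomm_poly)"
  by (simp_all add: free_algebra_def)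

lemma free_algebra_uminus [simp]:
  assumes "p \<in> carrier (free_algebra A)"
  shows "\<ominus>\<^bsub>free_algebra A\<^esub> p = - (p :: 'f::field noncomm_poly)"
proof -
  interpret ring "free_algebra A :: 'f noncomm_poly ring" by (rule ring_free_algebra)
  show ?thesis
    using assms by (intro minus_equality) (auto simp: carrier_free_algebra words.span_neg)
qed

lemma const_in_free_algebra: "const c \<in> carrier (free_algebra A)"
  by (auto simp: free_algebra_def const_def)

lemma monomial_in_free_algebra: "w \<in> lists A \<Longrightarrow> monomial w \<in> carrier (free_algebra A)"
  by (simp add: carrier_free_algebra words.span_base)

lemma subfield_range_const: "subfield (range const) (free_algebra A :: 'f::field noncomm_poly ring)"
proof -
  let ?R = "free_algebra A :: 'f noncomm_poly ring"
  interpret ring ?R by (rule ring_free_algebra)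
  have const_mult: "const a * const b = const (a * b)" and const_add: "const a + const b = const (a + b)"
    and const_uminus: "- const a = const (- a)" for a b :: 'f
    by (simp_all add: const_def mult_single plus_list_def single_add single_uminus)
  have const_one: "const 1 = (1 :: 'f noncomm_poly)"
    by (simp add: const_def zero_list_def flip: single_one)
  have const_nz: "const a = (0 :: 'f noncomm_poly) \<longleftrightarrow> a = 0" for a :: 'f
    by (metis const_def lookup_single_eq lookup_zero single_zero)
  have inverse: "const a * const (inverse a) = (1 :: 'f noncomm_poly)"
    "const (inverse a) * const a = (1 :: 'f noncomm_poly)" if "a \<noteq> 0" for a :: 'f
    using that by (simp_all add: const_mult const_one)
  show ?thesis
  proof (rule subfieldI)
    have "subring (range const) ?R"
      by (rule subringI)
        (auto simp: const_in_free_algebra const_mult const_add const_uminus simp flip: const_one)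
    then show "subcring (range const) ?R"
      by (rule subcringI) (auto simp: const_mult mult.commute)
    show "Units (?R \<lparr>carrier := range const\<rparr>) = range const - {\<zero>\<^bsub>?R\<^esub>}"
    proof (intro equalityI subsetI)
      fix x assume "x \<in> Units (?R \<lparr>carrier := range const\<rparr>)"
      then show "x \<in> range const - {\<zero>\<^bsub>?R\<^esub>}" by (auto simp: Units_def)
    next
      fix x assume "x \<in> range const - {\<zero>\<^bsub>?R\<^esub>}"
      then obtain a where "x = const a" "a \<noteq> 0" by (auto simp: const_nz)
      then show "x \<in> Units (?R \<lparr>carrier := range const\<rparr>)"
        using inverse[of a] unfolding Units_def by auto
    qed
  qed
qed

context monic_relations
begin

lemma multiples_in_carrier:
  "words.span (multiples P) \<subseteq> carrier (free_algebra A)"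
proof -
  have "b \<in> carrier (free_algebra A)" if b: "b \<in> multiples P" for b
  proof -
    obtain u i v where b: "b = monomial u * g i * monomial v" "i \<in> J" "u \<in> lists A" "v \<in> lists A"
      using b unfolding multiples_def by blast
    have "monomial (u @ lead i @ v) \<in> words.span (monomial ` lists A :: 'f noncomm_poly set)"
      using b lead_in by (intro words.span_base) auto
    moreover have "monomial (u @ lead i @ v) - b \<in> words.span (monomial ` lists A)"
      unfolding b(1)
      by (rule subsetD[OF words.span_mono[OF image_mono] tail_context[OF b(2-4)]]) blast
    ultimately have "monomial (u @ lead i @ v) - (monomial (u @ lead i @ v) - b) \<in> words.span (monomial ` lists A)"
      by (rule words.span_diff)
    then show ?thesis by (simp add: carrier_free_algebra)
  qed
  then show ?thesis
    unfolding carrier_free_algebra by (intro words.span_minimal[OF _ words.subspace_span] subsetI)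
qed

lemma relation_in_span: "i \<in> J \<Longrightarrow> g i \<in> words.span (multiples (\<lambda>_. True))"
  using multiplesI[of i "[]" "[]" "\<lambda>_. True"] by (simp add: monomial_Nil words.span_base)

lemma relations_in_carrier: "g ` J \<subseteq> carrier (free_algebra A)"
  using relation_in_span multiples_in_carrier by blast

text \<open>
  The span of the multiples is closed under multiplication because the words span the free algebra.
  This turns the ideal into the space to which the diamond lemma applies.
\<close>

lemma genideal_eq_span:
  "genideal (free_algebra A) (g ` J) = words.span (multiples (\<lambda>_. True))"
proof -
  let ?R = "free_algebra A :: 'f noncomm_poly ring" and ?I = "words.span (multiples (\<lambda>_. True))"
  interpret ring ?R by (rule ring_free_algebra)
  have gJ: "g ` J \<subseteq> ?I"
    using relation_in_span by blast
  have left: "x * p \<in> ?I" if "p \<in> ?I" "x \<in> carrier ?R" for p x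
  proof -
    have "1 * x * p \<in> ?I"
    proof (rule span_mult_subset[of x "monomial ` lists A"])
      show "x \<in> words.span (monomial ` lists A)" using that by (simp add: carrier_free_algebra)
      fix b :: "'f noncomm_poly" assume "b \<in> monomial ` lists A"
      then obtain w where w: "b = monomial w" "w \<in> lists A" by blast
      have "monomial w * p * 1 \<in> ?I" using that(1)
      proof (rule span_mult_subset)
        fix q assume "q \<in> multiples (\<lambda>_. True)"
        then obtain u i v where q: "q = monomial u * g i * monomial v" "i \<in> J" "u \<in> lists A" "v \<in> lists A"
          unfolding multiples_def by blast
        have "monomial (w @ u) * g i * monomial v \<in> multiples (\<lambda>_. True)"
          using q w by (intro multiplesI) auto
        then show "monomial w * q * 1 \<in> ?I"
          by (simp add: q mult.assoc words.span_base flip: monomial_mult)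
      qed
      then show "1 * b * p \<in> ?I" by (simp add: w)
    qed
    then show ?thesis by simp
  qed
  have right: "p * x \<in> ?I" if "p \<in> ?I" "x \<in> carrier ?R" for p x
  proof -
    have "p * x * 1 \<in> ?I"
    proof (rule span_mult_subset[of x "monomial ` lists A"])
      show "x \<in> words.span (monomial ` lists A)" using that by (simp add: carrier_free_algebra)
      fix b :: "'f noncomm_poly" assume "b \<in> monomial ` lists A"
      then obtain w where w: "b = monomial w" "w \<in> lists A" by blast
      have "1 * p * monomial w \<in> ?I" using that(1)
      proof (rule span_mult_subset)
        fix q assume "q \<in> multiples (\<lambda>_. True)"
        then obtain u i v where q: "q = monomial u * g i * monomial v" "i \<in> J" "u \<in> lists A" "v \<in> lists A"
          unfolding multiples_def by blast
        have "monomial u * g i * monomial (v @ w) \<in> multiples (\<lambda>_. True)"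
          using q w by (intro multiplesI) auto
        then show "1 * q * monomial w \<in> ?I"
          by (simp add: q mult.assoc words.span_base flip: monomial_mult)
      qed
      then show "p * b * 1 \<in> ?I" by (simp add: w)
    qed
    then show ?thesis by simp
  qed
  have "ideal ?I ?R"
  proof (rule idealI[OF ring_axioms])
    show "subgroup ?I (add_monoid ?R)"
    proof (rule add.subgroupI)
      show "?I \<subseteq> carrier ?R" by (rule multiples_in_carrier)
      show "?I \<noteq> {}" using words.span_zero by blast
      fix a b assume "a \<in> ?I" "b \<in> ?I"
      then show "a \<oplus>\<^bsub>?R\<^esub> b \<in> ?I" by (simp add: words.span_add)
    next
      fix a assume a: "a \<in> ?I"
      then have "a \<in> carrier ?R" using multiples_in_carrier by blast
      then show "\<ominus>\<^bsub>?R\<^esub> a \<in> ?I" using a by (simp add: words.span_neg)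
    qed
  qed (use left right in auto)
  then have "genideal ?R (g ` J) \<subseteq> ?I"
    using gJ by (rule genideal_minimal)
  moreover have "?I \<subseteq> genideal ?R (g ` J)"
  proof -
    interpret I: ideal "genideal ?R (g ` J)" ?R
      by (rule genideal_ideal[OF relations_in_carrier])
    have gens: "monomial u * g i * monomial v \<in> genideal ?R (g ` J)"
      if "i \<in> J" "u \<in> lists A" "v \<in> lists A" for u i v
    proof -
      have "g i \<in> genideal ?R (g ` J)"
        using that(1) genideal_self[OF relations_in_carrier] by blast
      then have "monomial u * g i \<in> genideal ?R (g ` J)"
        using I.I_l_closed[OF _ monomial_in_free_algebra[OF that(2)]] by simp
      then show ?thesis
        using I.I_r_closed[OF _ monomial_in_free_algebra[OF that(3)]] by simp
    qed
    have "words.subspace (genideal ?R (g ` J))"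
      using I.zero_closed I.a_closed I.I_l_closed[OF _ const_in_free_algebra]
      by (intro words.subspaceI) auto
    then show ?thesis
      using gens by (intro words.span_minimal) (auto simp: multiples_def)
  qed
  ultimately show ?thesis by blast
qed

text \<open>
  Irreducible words span the quotient: a reducible word is congruent to a combination of smaller
  words, so well-founded induction applies.
\<close>

lemma monomial_mod_relations:
  assumes "w \<in> lists A"
  shows "monomial w \<in> words.span (monomial ` (lists A - reducible) \<union> multiples (\<lambda>_. True))"
proof -
  let ?S = "words.span (monomial ` (lists A - reducible) \<union> multiples (\<lambda>_. True))"
  have "wf (lenlex less_than)" by (rule wf_lenlex[OF wf_less_than])
  then show ?thesis using assms
  proof (induction w rule: wf_induct_rule)
    case (less w)
    show ?case
    proof (cases "w \<in> reducible")
      case False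
      then show ?thesis using less.prems by (intro words.span_base UnI1 imageI) blast
    next
      case True
      then obtain u i v where w: "w = u @ lead i @ v" "i \<in> J" "u \<in> lists A" "v \<in> lists A"
        unfolding reducible_def by blast
      have "monomial w - monomial u * g i * monomial v \<in> words.span (monomial ` {m \<in> lists A. m \<lless> w})"
        using tail_context[OF w(2-4)] unfolding w(1)[symmetric] .
      also have "\<dots> \<subseteq> ?S"
      proof (rule words.span_minimal[OF _ words.subspace_span], rule subsetI)
        fix b :: "'f noncomm_poly" assume "b \<in> monomial ` {m \<in> lists A. m \<lless> w}"
        then show "b \<in> ?S" using less.IH by auto
      qed
      finally have "monomial w - monomial u * g i * monomial v \<in> ?S" .
      moreover have "monomial u * g i * monomial v \<in> ?S"
        using w by (intro words.span_base UnI2 multiplesI) auto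
      ultimately have "(monomial w - monomial u * g i * monomial v) + monomial u * g i * monomial v \<in> ?S"
        by (rule words.span_add)
      then show ?thesis by simp
    qed
  qed
qed

end

context groebner_basis
begin

abbreviation quotient :: "'f noncomm_poly set ring" where
  "quotient \<equiv> free_algebra A Quot genideal (free_algebra A) (g ` J)"

abbreviation coset :: "'f noncomm_poly \<Rightarrow> 'f noncomm_poly set" where
  "coset p \<equiv> genideal (free_algebra A) (g ` J) +>\<^bsub>free_algebra A\<^esub> p"

abbreviation scalars :: "'f noncomm_poly set set" where
  "scalars \<equiv> range (\<lambda>c. coset (const c))"

lemma ideal_relations: "ideal (genideal (free_algebra A) (g ` J)) (free_algebra A)"
  using ring.genideal_ideal[OF ring_free_algebra relations_in_carrier] .

lemma coset_hom: "ring_hom_ring (free_algebra A) quotient coset"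
  by (rule ideal.rcos_ring_hom_ring[OF ideal_relations])

lemma carrier_quotient: "carrier quotient = coset ` carrier (free_algebra A)"
  by (auto simp: FactRing_def A_RCOSETS_def')

lemma coset_eq_iff:
  assumes "p \<in> carrier (free_algebra A)" "q \<in> carrier (free_algebra A)"
  shows "coset p = coset q \<longleftrightarrow> p - q \<in> words.span (multiples (\<lambda>_. True))"
proof -
  interpret ideal "genideal (free_algebra A) (g ` J)" "free_algebra A" by (rule ideal_relations)
  show ?thesis
    using quotient_eq_iff_same_a_r_cos[OF ideal_relations assms] assms
    by (simp add: a_minus_def genideal_eq_span)
qed

text \<open>
  The diamond lemma in the form used for linear independence: a coset contains at most one normal form.
\<close>

lemma normal_coset_inj:
  assumes "p \<in> words.span (monomial ` (lists A - reducible))"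
    and "q \<in> words.span (monomial ` (lists A - reducible))" and "coset p = coset q"
  shows "p = q"
proof -
  have sub: "words.span (monomial ` (lists A - reducible)) \<subseteq> carrier (free_algebra A)"
    unfolding carrier_free_algebra by (intro words.span_mono image_mono) auto
  have "p - q \<in> words.span (multiples (\<lambda>_. True))"
    using assms sub coset_eq_iff by blast
  moreover have "Poly_Mapping.keys (p - q) \<inter> reducible = {}"
    using words.span_diff[OF assms(1,2)] by (auto simp: span_monomials)
  ultimately have "p - q = 0" by (rule span_multiples_inter_normal)
  then show ?thesis by simp
qed

lemma inj_on_coset_monomial: "inj_on (\<lambda>w. coset (monomial w)) (lists A - reducible)"
proof (rule inj_onI)
  fix u v assume "u \<in> lists A - reducible" "v \<in> lists A - reducible"
    and "coset (monomial u) = coset (monomial v)"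
  then have "monomial u = (monomial v :: 'f noncomm_poly)"
    by (intro normal_coset_inj words.span_base) auto
  then have "Poly_Mapping.lookup (monomial u :: 'f noncomm_poly) u = Poly_Mapping.lookup (monomial v) u"
    by simp
  then show "u = v" by (simp add: lookup_monomial split: if_splits)
qed

text \<open>
  Translation between spans over the copy of the ground field in the quotient ring and spans in
  the free algebra.
\<close>

lemma Span_coset_monomials:
  assumes "set ws \<subseteq> lists A"
  shows "ring.Span quotient scalars (map (\<lambda>w. coset (monomial w)) ws) =
    coset ` words.span (monomial ` set ws)"
  using assms
proof (induction ws)
  interpret ring_hom_ring "free_algebra A" quotient coset by (rule coset_hom)
  case Nil
  then show ?case using hom_zero by simp
next
  interpret ring_hom_ring "free_algebra A" quotient coset by (rule coset_hom)
  case (Cons w ws)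
  let ?S = "words.span (monomial ` set ws) :: 'f noncomm_poly set"
  have sub: "?S \<subseteq> carrier (free_algebra A)"
    unfolding carrier_free_algebra using Cons.prems by (intro words.span_mono image_mono) auto
  have w: "monomial w \<in> carrier (free_algebra A)"
    using Cons.prems by (intro monomial_in_free_algebra) auto
  have coset: "coset (const c) \<otimes>\<^bsub>quotient\<^esub> coset (monomial w) \<oplus>\<^bsub>quotient\<^esub> coset p =
    coset (const c * monomial w + p)" if "p \<in> ?S" for c p
  proof -
    have "const c * monomial w \<in> carrier (free_algebra A)"
      using R.m_closed[OF const_in_free_algebra w] by simp
    then show ?thesis
      using hom_mult[OF const_in_free_algebra w] hom_add[of "const c * monomial w" p] sub that by auto
  qed
  have "S.Span scalars (u # us) = S.line_extension scalars u (S.Span scalars us)" for u us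
    by simp
  then have "ring.Span quotient scalars (map (\<lambda>w. coset (monomial w)) (w # ws)) =
    S.line_extension scalars (coset (monomial w)) (coset ` ?S)"
    unfolding list.map using Cons.IH Cons.prems by (simp only: set_simps insert_subset)
  also have "\<dots> = {coset (const c * monomial w + p) | c p. p \<in> ?S}"
  proof (intro equalityI subsetI)
    fix x assume "x \<in> S.line_extension scalars (coset (monomial w)) (coset ` ?S)"
    then obtain c p where "p \<in> ?S"
      "x = coset (const c) \<otimes>\<^bsub>quotient\<^esub> coset (monomial w) \<oplus>\<^bsub>quotient\<^esub> coset p"
      unfolding S.line_extension_mem_iff by blast
    then show "x \<in> {coset (const c * monomial w + p) | c p. p \<in> ?S}"
      unfolding coset[OF \<open>p \<in> ?S\<close>] by blast
  next
    fix x assume "x \<in> {coset (const c * monomial w + p) | c p. p \<in> ?S}"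
    then obtain c p where "p \<in> ?S" "x = coset (const c * monomial w + p)" by blast
    then show "x \<in> S.line_extension scalars (coset (monomial w)) (coset ` ?S)"
      unfolding S.line_extension_mem_iff coset[OF \<open>p \<in> ?S\<close>, symmetric] by blast
  qed
  also have "\<dots> = coset ` words.span (insert (monomial w) (monomial ` set ws))"
  proof -
    have "words.span (insert (monomial w) (monomial ` set ws)) = {const c * monomial w + p | c p. p \<in> ?S}"
      unfolding words.span_insert
    proof (intro equalityI subsetI; clarify)
      fix x c assume "x - const c * monomial w \<in> ?S"
      then show "\<exists>c p. x = const c * monomial w + p \<and> p \<in> ?S"
        by (intro exI[of _ c] exI[of _ "x - const c * monomial w"]) simp
    next
      fix c p assume "p \<in> ?S"
      then show "\<exists>k. const c * monomial w + p - const k * monomial w \<in> ?S"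
        by (intro exI[of _ c]) simp
    qed
    then show ?thesis by auto
  qed
  finally show ?case by simp
qed

lemma independent_coset_monomials:
  assumes "distinct ws" "set ws \<subseteq> lists A - reducible"
  shows "ring.independent quotient scalars (map (\<lambda>w. coset (monomial w)) ws)"
  using assms
proof (induction ws)
  interpret ring_hom_ring "free_algebra A" quotient coset by (rule coset_hom)
  case Nil
  show ?case by simp
next
  interpret ring_hom_ring "free_algebra A" quotient coset by (rule coset_hom)
  case (Cons w ws)
  have "coset (monomial w) \<notin> coset ` words.span (monomial ` set ws)"
  proof
    assume "coset (monomial w) \<in> coset ` words.span (monomial ` set ws)"
    then obtain p where p: "p \<in> words.span (monomial ` set ws)" "coset (monomial w) = coset p" by blast
    have "words.span (monomial ` set ws :: 'f noncomm_poly set) \<subseteq> words.span (monomial ` (lists A - reducible))"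
      using Cons.prems by (intro words.span_mono image_mono) auto
    then have "monomial w = p"
      using p Cons.prems by (intro normal_coset_inj) (auto intro: words.span_base)
    then have "w \<in> set ws"
      using p(1) by (auto simp: span_monomials in_keys_iff lookup_monomial split: if_splits)
    then show False using Cons.prems by simp
  qed
  moreover have "coset (monomial w) \<in> carrier quotient"
    using Cons.prems by (intro hom_closed monomial_in_free_algebra) auto
  moreover have "S.independent scalars (map (\<lambda>w. coset (monomial w)) ws)"
    using Cons.prems by (intro Cons.IH) simp_all
  moreover have "set ws \<subseteq> lists A" using Cons.prems by auto
  ultimately show ?case
    unfolding list.map by (intro S.independent.li_Cons) (simp_all only: Span_coset_monomials not_False_eq_True)
qed

theorem is_basis_normal_words:
  "is_basis quotient scalars ((\<lambda>w. coset (monomial w)) ` (lists A - reducible))"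
  unfolding is_basis_def
proof (intro conjI allI impI ballI)
  interpret ring_hom_ring "free_algebra A" quotient coset by (rule coset_hom)
  show "(\<lambda>w. coset (monomial w)) ` (lists A - reducible) \<subseteq> carrier quotient"
    using hom_closed monomial_in_free_algebra by blast
next
  fix us assume us: "distinct us" "set us \<subseteq> (\<lambda>w. coset (monomial w)) ` (lists A - reducible)"
  then have "us \<in> map (\<lambda>w. coset (monomial w)) ` lists (lists A - reducible)"
    unfolding lists_image[symmetric] by (simp add: in_lists_conv_set subset_eq)
  then obtain ws where ws: "ws \<in> lists (lists A - reducible)" "us = map (\<lambda>w. coset (monomial w)) ws"
    by blast
  then have "set ws \<subseteq> lists A - reducible"
    unfolding lists_eq_set by blast
  then show "ring.independent quotient scalars us"
    using us(1) ws(2) independent_coset_monomials[of ws] by (simp add: distinct_map)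
next
  fix v assume "v \<in> carrier quotient"
  then obtain p where p: "p \<in> carrier (free_algebra A)" "v = coset p"
    unfolding carrier_quotient by blast
  \<comment> \<open>The normal form of \<open>p\<close> is the summand \<open>q\<close> in the decomposition below.\<close>
  have "carrier (free_algebra A) \<subseteq> words.span (monomial ` (lists A - reducible) \<union> multiples (\<lambda>_. True))"
    unfolding carrier_free_algebra
    using monomial_mod_relations by (intro words.span_minimal[OF _ words.subspace_span]) blast
  then obtain q r where qr: "q \<in> words.span (monomial ` (lists A - reducible))"
    "r \<in> words.span (multiples (\<lambda>_. True))" "p = q + r"
    using p(1) unfolding words.span_Un by blast
  obtain ws where ws: "set ws = Poly_Mapping.keys q"
    using finite_list[OF finite_keys[of q]] by blast
  then have sub: "set ws \<subseteq> lists A - reducible"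
    using qr(1) by (simp add: span_monomials)
  have "q \<in> words.span (monomial ` set ws)"
    by (simp add: span_monomials ws)
  moreover have "v = coset q"
    unfolding p(2) using p(1) qr words.span_mono[of "monomial ` (lists A - reducible)" "monomial ` lists A"]
    by (subst coset_eq_iff) (auto simp: carrier_free_algebra)
  ultimately have "v \<in> ring.Span quotient scalars (map (\<lambda>w. coset (monomial w)) ws)"
    using Span_coset_monomials[of ws] sub by auto
  then show "\<exists>us. set us \<subseteq> (\<lambda>w. coset (monomial w)) ` (lists A - reducible) \<and>
      v \<in> ring.Span quotient scalars us"
    using sub by (intro exI[of _ "map (\<lambda>w. coset (monomial w)) ws"]) auto
qed

theorem infinite_dimension_quotient:
  assumes "infinite (lists A - reducible)"
  shows "\<not> ring.finite_dimension quotient scalars (carrier quotient)"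
proof
  interpret ring_hom_ring "free_algebra A" quotient coset by (rule coset_hom)
  assume "ring.finite_dimension quotient scalars (carrier quotient)"
  then obtain m where m: "S.dimension m scalars (carrier quotient)"
    unfolding S.finite_dimension_def by blast
  have independent: "ring.independent quotient scalars (map (\<lambda>w. coset (monomial w)) ws)"
    if "distinct ws" "set ws \<subseteq> lists A - reducible" for ws
    using independent_coset_monomials that .
  \<comment> \<open>The scalars form a field only in a nontrivial quotient.\<close>
  have "\<one>\<^bsub>quotient\<^esub> \<noteq> \<zero>\<^bsub>quotient\<^esub>"
  proof
    assume *: "\<one>\<^bsub>quotient\<^esub> = \<zero>\<^bsub>quotient\<^esub>"
    obtain w where w: "w \<in> lists A - reducible"
      using assms by (metis ex_in_conv finite.emptyI)
    then have "coset (monomial w) \<in> carrier quotient"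
      using hom_closed monomial_in_free_algebra by blast
    then have "coset (monomial w) = coset 0"
      using S.one_zeroD[OF *] hom_zero by simp
    then have "monomial w = (0 :: 'f noncomm_poly)"
      using w by (intro normal_coset_inj) (auto intro: words.span_base words.span_zero)
    then have "Poly_Mapping.lookup (monomial w :: 'f noncomm_poly) w = 0" by simp
    then show False by (simp add: lookup_monomial)
  qed
  then have "subfield scalars quotient"
    using img_is_subfield(2)[OF subfield_range_const] by (simp add: image_image)
  moreover obtain W where W: "W \<subseteq> lists A - reducible" "finite W" "card W = Suc m"
    using infinite_arbitrarily_large[OF assms] by metis
  obtain ws where ws: "set ws = W" "distinct ws"
    using finite_distinct_list[OF W(2)] by blast
  moreover have "set (map (\<lambda>w. coset (monomial w)) ws) \<subseteq> carrier quotient"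
  proof -
    have "coset (monomial w) \<in> carrier quotient" if "w \<in> set ws" for w
      using that W(1) ws(1) by (intro hom_closed monomial_in_free_algebra) blast
    then show ?thesis by auto
  qed
  ultimately have "length (map (\<lambda>w. coset (monomial w)) ws) \<le> m"
    using S.independent_length_le_dimension[OF _ m independent] W(1) by blast
  then show False
    using W(3) ws distinct_card by fastforce
qed

end


section \<open>Alternating sums\<close>

definition delete_nth :: "nat \<Rightarrow> 'a list \<Rightarrow> 'a list" where
  "delete_nth j zs = take j zs @ drop (Suc j) zs"

lemma length_delete_nth: "j < length zs \<Longrightarrow> length (delete_nth j zs) = length zs - 1"
  by (simp add: delete_nth_def)

lemma delete_nth_map: "delete_nth j (map f zs) = map f (delete_nth j zs)"
  by (simp add: delete_nth_def take_map drop_map)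

lemma set_delete_nth: "set (delete_nth j zs) \<subseteq> set zs"
  using set_take_subset[of j zs] set_drop_subset[of "Suc j" zs] by (auto simp: delete_nth_def)

lemma nth_delete_nth:
  assumes "j < length zs" "k < length zs - 1"
  shows "delete_nth j zs ! k = zs ! insert_index j k"
  using assms by (auto simp: delete_nth_def insert_index_def nth_append min_def)

lemma prod_permute_list:
  "prod_list (permute_list \<sigma> zs) = prod_list (map (\<lambda>i. zs ! \<sigma> i) [0..<length zs])"
  by (simp add: permute_list_def)

text \<open>
  The permutations are grouped by the value \<open>j\<close> at a fixed position \<open>i\<close>. Those in one group come from
  permutations of the remaining \<open>m\<close> indices, at the cost of the sign \<open>(-1)\<^sup>i\<^sup>+\<^sup>j\<close>.
\<close>

lemma alt_eq_sum_position:
  fixes zs :: "'a::ring_1 list"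
  assumes "length zs = Suc m" and i: "i < Suc m"
  shows "alt zs = (\<Sum>j<Suc m. \<Sum>q | q permutes {..<m}. (-1) ^ (i + j) * (of_int (sign q) *
    prod_list (permute_list (permutation_insert i j q) zs)))"
proof -
  let ?f = "\<lambda>p. of_int (sign p) * prod_list (permute_list p zs)"
  have "alt zs = (\<Sum>p | p permutes {0..<Suc m}. ?f p)"
    by (simp add: alt_def assms lessThan_atLeast0)
  also have "\<dots> = (\<Sum>j\<in>{0..<Suc m}. sum ?f {p. p \<in> {p. p permutes {0..<Suc m}} \<and> p i = j})"
  proof (rule sum.group[symmetric])
    show "finite {p. p permutes {0..<Suc m}}" by (simp add: finite_permutations)
    show "(\<lambda>p. p i) ` {p. p permutes {0..<Suc m}} \<subseteq> {0..<Suc m}"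
      using i permutes_in_image[of _ "{0..<Suc m}" i] by auto
  qed simp
  also have "\<dots> = (\<Sum>j<Suc m. sum ?f (permutation_insert i j ` {q. q permutes {0..<m}}))"
    using permutation_fix[OF i] by (intro sum.cong) (auto simp: lessThan_atLeast0)
  also have "\<dots> = (\<Sum>j<Suc m. \<Sum>q | q permutes {0..<m}. ?f (permutation_insert i j q))"
    by (intro sum.cong refl sum.reindex[unfolded o_def] permutation_insert_inj_on) (use i in auto)
  also have "\<dots> = (\<Sum>j<Suc m. \<Sum>q | q permutes {..<m}. (-1) ^ (i + j) * (of_int (sign q) *
    prod_list (permute_list (permutation_insert i j q) zs)))"
    using signof_permutation_insert[of _ m i _, where 'a='a] i
    by (intro sum.cong) (auto simp: lessThan_atLeast0 mult.assoc)
  finally show ?thesis .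
qed

lemma alt_expand_first:
  fixes zs :: "'a::ring_1 list"
  assumes len: "length zs = Suc m"
  shows "alt zs = (\<Sum>j<Suc m. (-1) ^ j * (zs ! j * alt (delete_nth j zs)))"
proof -
  have "prod_list (permute_list (permutation_insert 0 j q) zs) =
      zs ! j * prod_list (permute_list q (delete_nth j zs))"
    if j: "j < Suc m" and q: "q permutes {..<m}" for j q
  proof -
    have "zs ! permutation_insert 0 j q (Suc k) = delete_nth j zs ! q k" if "k < m" for k
      using that j len permutes_in_image[OF q, of k]
      by (auto simp: nth_delete_nth permutation_insert_expand insert_index_def)
    then have "map (\<lambda>k. zs ! permutation_insert 0 j q (Suc k)) [0..<m] =
        map (\<lambda>k. delete_nth j zs ! q k) [0..<m]"
      by simp
    then have "map (\<lambda>k. zs ! permutation_insert 0 j q k) [0..<Suc m] =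
        zs ! j # map (\<lambda>k. delete_nth j zs ! q k) [0..<m]"
      by (simp add: upt_conv_Cons flip: map_Suc_upt del: upt_Suc)
    then show ?thesis
      using j len by (simp add: prod_permute_list length_delete_nth del: upt_Suc)
  qed
  moreover have "s * (of_int (c::int) * (x * y)) = s * (x * (of_int c * y))" for s x y :: 'a and c
    by (simp flip: mult.assoc mult_of_int_commute)
  ultimately show ?thesis
    by (simp add: alt_eq_sum_position[OF len, of 0] alt_def[of "delete_nth _ zs"] length_delete_nth
      len sum_distrib_left del: sum.lessThan_Suc)
qed

lemma alt_expand_last:
  fixes zs :: "'a::ring_1 list"
  assumes len: "length zs = Suc m"
  shows "alt zs = (\<Sum>j<Suc m. (-1) ^ (m + j) * (alt (delete_nth j zs) * zs ! j))"
proof -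
  have "prod_list (permute_list (permutation_insert m j q) zs) =
      prod_list (permute_list q (delete_nth j zs)) * zs ! j"
    if j: "j < Suc m" and q: "q permutes {..<m}" for j q
  proof -
    have "zs ! permutation_insert m j q k = delete_nth j zs ! q k" if "k < m" for k
      using that j len permutes_in_image[OF q, of k]
      by (auto simp: nth_delete_nth permutation_insert_expand insert_index_def)
    then have eq: "map (\<lambda>k. zs ! permutation_insert m j q k) [0..<m] =
        map (\<lambda>k. delete_nth j zs ! q k) [0..<m]"
      by simp
    show ?thesis
      using j by (simp add: prod_permute_list length_delete_nth len eq)
  qed
  then show ?thesis
    by (simp add: alt_eq_sum_position[OF len, of m] alt_def[of "delete_nth _ zs"] length_delete_nth
      len sum_distrib_left sum_distrib_right mult.assoc del: sum.lessThan_Suc)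
qed

lemma span_sign_mult: "p \<in> words.span B \<Longrightarrow> (-1) ^ k * (p :: 'f::field noncomm_poly) \<in> words.span B"
  by (cases "even k") (simp_all add: words.span_neg)

lemma alt_gen_in_span:
  "(alt (map gen ws) :: 'f::field noncomm_poly) \<in>
    words.span (monomial ` {m \<in> lists (set ws). length m = length ws})"
  unfolding alt_def
proof (rule words.span_sum)
  fix \<sigma> assume "\<sigma> \<in> {\<sigma>. \<sigma> permutes {..<length (map gen ws :: 'f noncomm_poly list)}}"
  then have \<sigma>: "\<sigma> permutes {..<length ws}" by simp
  let ?m = "permute_list \<sigma> ws"
  have prod: "prod_list (permute_list \<sigma> (map gen ws)) = (monomial ?m :: 'f noncomm_poly)"
    unfolding permute_list_map[OF \<sigma>] monomial_eq_prod_list[of ?m] ..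
  have "(monomial ?m :: 'f noncomm_poly) \<in>
    words.span (monomial ` {m \<in> lists (set ws). length m = length ws})"
    using set_permute_list[OF \<sigma>] by (intro words.span_base imageI) auto
  moreover from this have "- (monomial ?m :: 'f noncomm_poly) \<in>
    words.span (monomial ` {m \<in> lists (set ws). length m = length ws})"
    by (rule words.span_neg)
  moreover have "of_int (sign \<sigma>) * (monomial ?m :: 'f noncomm_poly) = monomial ?m \<or>
      of_int (sign \<sigma>) * (monomial ?m :: 'f noncomm_poly) = - monomial ?m"
    by (simp add: sign_def)
  ultimately show "of_int (sign \<sigma>) * prod_list (permute_list \<sigma> (map gen ws)) \<in>
    (words.span (monomial ` {m \<in> lists (set ws). length m = length ws}) :: 'f noncomm_poly set)"
    by (elim disjE) (simp_all only: prod)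
qed

lemma deglex_head: "length v = length w \<Longrightarrow> x < y \<Longrightarrow> x # v \<lless> y # w"
  by (simp add: Cons_lenlex_iff)

text \<open>
  The largest word starts with the largest letter \<open>x\<close>. In the expansion along the first factor only
  the term with \<open>x\<close> in front contributes such words, and it is \<open>x\<close> times an alternating sum in one
  letter less. The sign is that of the reversal of the list.
\<close>

lemma leading_word_alt:
  assumes "sorted_wrt (<) ws"
  shows "monomial (rev ws) - (-1) ^ (length ws div 2) * (alt (map gen ws) :: 'f::field noncomm_poly) \<in>
    words.span (monomial ` {m \<in> lists (set ws). m \<lless> rev ws})"
  using assms
proof (induction ws rule: rev_induct)
  case Nil
  have "alt (map gen []) = (1 :: 'f noncomm_poly)"
    by (simp add: alt_def)
  then show ?case
    by (simp add: monomial_Nil words.span_zero)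
next
  case (snoc x ws)
  define n where "n = length ws"
  let ?zs = "map gen (ws @ [x]) :: 'f noncomm_poly list"
  let ?S = "words.span (monomial ` {m \<in> lists (set (ws @ [x])). m \<lless> rev (ws @ [x])}) :: 'f noncomm_poly set"
  define s s' :: "'f noncomm_poly" where "s = (-1) ^ (n div 2)" and "s' = (-1) ^ (Suc n div 2)"
  \<comment> \<open>Reversing \<open>n + 1\<close> letters amounts to moving one letter past \<open>n\<close> others and reversing those.\<close>
  have sign: "s' * (-1) ^ n = s"
    unfolding s_def s'_def by (cases "even n") (auto elim!: oddE evenE)
  have "monomial (rev ws) - s * alt (map gen ws) \<in>
    words.span (monomial ` {m \<in> lists (set ws). m \<lless> rev ws})"
    unfolding s_def n_def using snoc.prems by (intro snoc.IH) (simp add: sorted_wrt_append)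
  then have lower: "gen x * (monomial (rev ws) - s * alt (map gen ws)) * 1 \<in> ?S"
  proof (rule span_mult_subset)
    fix b :: "'f noncomm_poly" assume "b \<in> monomial ` {m \<in> lists (set ws). m \<lless> rev ws}"
    then obtain m where "b = monomial m" "m \<in> lists (set ws)" "m \<lless> rev ws" by blast
    then have "x # m \<in> {m \<in> lists (set (ws @ [x])). m \<lless> rev (ws @ [x])}"
      by (auto simp: Cons_lenlex_iff)
    then have "monomial (x # m) \<in> ?S"
      by (intro words.span_base imageI)
    then show "gen x * b * 1 \<in> ?S"
      by (simp add: \<open>b = monomial m\<close> monomial_mult)
  qed
  have others: "?zs ! j * alt (delete_nth j ?zs) \<in> ?S" if j: "j < n" for j
  proof -
    have jx: "ws ! j < x"
      using snoc.prems j by (simp add: sorted_wrt_append n_def)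
    have "delete_nth j ?zs = map gen (delete_nth j (ws @ [x]))"
      by (rule delete_nth_map)
    then have "alt (delete_nth j ?zs) \<in>
      words.span (monomial ` {m \<in> lists (set (delete_nth j (ws @ [x]))). length m = length (delete_nth j (ws @ [x]))})"
      by (simp only: alt_gen_in_span)
    then have "gen (ws ! j) * alt (delete_nth j ?zs) * 1 \<in> ?S"
    proof (rule span_mult_subset)
      fix b :: "'f noncomm_poly"
      assume "b \<in> monomial ` {m \<in> lists (set (delete_nth j (ws @ [x]))). length m = length (delete_nth j (ws @ [x]))}"
      then obtain m where m: "b = monomial m" "set m \<subseteq> set (delete_nth j (ws @ [x]))" "length m = n"
        using j by (auto simp: length_delete_nth n_def)
      have "ws ! j # m \<in> lists (set (ws @ [x]))"
        using m(2) j set_delete_nth[of j "ws @ [x]"] by (auto simp: n_def)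
      moreover have "ws ! j # m \<lless> rev (ws @ [x])"
        using m(3) jx by (simp add: deglex_head n_def)
      ultimately have "monomial (ws ! j # m) \<in> ?S"
        by (intro words.span_base imageI CollectI conjI)
      then show "gen (ws ! j) * b * 1 \<in> ?S"
        by (simp add: m(1) monomial_mult)
    qed
    then show ?thesis
      using j by (simp add: nth_append n_def)
  qed
  have "alt ?zs = (\<Sum>j<n. (-1) ^ j * (?zs ! j * alt (delete_nth j ?zs))) + (-1) ^ n * (gen x * alt (map gen ws))"
    by (simp add: alt_expand_first[of _ n] n_def nth_append delete_nth_def)
  then have "monomial (rev (ws @ [x])) - s' * alt ?zs =
      gen x * (monomial (rev ws) - s * alt (map gen ws)) * 1 -
      s' * (\<Sum>j<n. (-1) ^ j * (?zs ! j * alt (delete_nth j ?zs)))"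
    unfolding sign[symmetric] s'_def
    by (cases "even n"; cases "even (Suc n div 2)") (simp_all add: algebra_simps monomial_mult)
  also have "\<dots> \<in> ?S"
    using others unfolding s'_def
    by (intro words.span_diff lower span_sign_mult words.span_sum) simp
  finally show ?case by (simp add: s'_def n_def)
qed


section \<open>The relations of the envelope\<close>

text \<open>
  The defining relations of the envelope, in the form given by \<open>env_relation_eq\<close>.
\<close>

definition alt_relation :: "nat \<Rightarrow> nat \<Rightarrow> 'f::field noncomm_poly" where
  "alt_relation n i = (-1) ^ (n div 2) * (alt (map gen (omit n i)) - (-1) ^ (n + i + 1) * gen i)"

lemma upt_split_at:
  assumes "i \<in> {1..n + 1}"
  shows "[1..<n + 2] = [1..<i] @ i # [Suc i..<n + 2]"
proof -
  from assms have "i < n + 2" by simp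
  then obtain k where "n + 2 = Suc (i + k)"
    by (blast dest: less_imp_Suc_add)
  then have k: "n + 2 = i + Suc k" by simp
  have "[1..<i + Suc k] = [1..<i] @ [i..<i + Suc k]"
    using assms by (intro upt_add_eq_append) simp
  also have "[i..<i + Suc k] = i # [Suc i..<i + Suc k]"
    by (intro upt_conv_Cons) simp
  finally show ?thesis unfolding k .
qed

lemma omit_eq:
  assumes "i \<in> {1..n + 1}"
  shows "omit n i = [1..<i] @ [Suc i..<n + 2]"
  unfolding omit_def upt_split_at[OF assms] by (simp add: filter_id_conv del: upt_Suc)

lemma set_omit: "set (omit n i) = {1..n + 1} - {i}"
  by (auto simp: omit_def)

lemma set_omit_inj:
  assumes "i \<in> {1..n + 1}" "set (omit n i) = set (omit n j)"
  shows "i = j"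
  using assms unfolding set_omit by blast

lemma length_omit: "i \<in> {1..n + 1} \<Longrightarrow> length (omit n i) = n"
  by (simp add: omit_eq del: upt_Suc)

lemma sorted_omit: "sorted_wrt (<) (omit n i)"
  unfolding omit_def by (intro sorted_wrt_filter) (simp del: upt_Suc)

text \<open>
  Identifies the factors that are forbidden in normal words with the leading words of the relations.
\<close>

lemma decreasing_word_eq:
  assumes "sorted_wrt (>) u" "set u \<subseteq> {1..n + 1}" "length u = n"
  obtains i where "i \<in> {1..n + 1}" "u = rev (omit n i)"
proof -
  have sorted: "sorted_wrt (<) (rev u)"
    using assms(1) by (simp add: sorted_wrt_rev)
  then have "card (set u) = n"
    using assms(3) distinct_card[of "rev u"] by (simp add: strict_sorted_iff)
  then have "card ({1..n + 1} - set u) = 1"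
    using assms(2) by (simp add: card_Diff_subset)
  then obtain i where i: "{1..n + 1} - set u = {i}"
    by (auto simp: card_1_singleton_iff)
  then have "set (rev u) = set (omit n i)"
    using assms(2) by (auto simp: set_omit)
  then have "rev u = omit n i"
    using sorted sorted_omit strict_sorted_equal by blast
  then show ?thesis
    using that[of i] i by (metis DiffE rev_rev_ident singletonI)
qed

text \<open>
  Glued along a nonempty overlap, two decreasing words form a decreasing word. It has more than \<open>n\<close>
  letters, so it contains each of the \<open>n + 1\<close> letters once.
\<close>

lemma overlap_of_leading_words:
  assumes i: "i \<in> {1..n + 1}" and j: "j \<in> {1..n + 1}"
    and ab: "rev (omit n i) = a @ b" and bc: "rev (omit n j) = b @ c"
    and nonempty: "a \<noteq> []" "b \<noteq> []" "c \<noteq> []"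
  shows "a = [n + 1]" "c = [1]" "i = 1" "j = n + 1" "a @ b @ c = rev [1..<n + 2]"
proof -
  have sorted: "sorted_wrt (>) (a @ b)" "sorted_wrt (>) (b @ c)"
    using sorted_omit[of n i] sorted_omit[of n j] by (simp_all add: sorted_wrt_rev flip: ab bc)
  obtain z where "z \<in> set b" using nonempty(2) by (meson list.set_sel(1))
  then have "sorted_wrt (>) (a @ b @ c)"
    using sorted by (fastforce simp: sorted_wrt_append)
  then have W: "sorted_wrt (<) (rev (a @ b @ c))"
    by (simp add: sorted_wrt_rev del: rev_append)
  then have dist: "distinct (a @ b @ c)"
    using distinct_rev strict_sorted_iff by blast
  have set_ab: "set (a @ b) = {1..n + 1} - {i}" and set_bc: "set (b @ c) = {1..n + 1} - {j}"
    unfolding ab[symmetric] bc[symmetric] by (simp_all add: set_omit)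
  then have sub: "set (a @ b @ c) \<subseteq> {1..n + 1}" by auto
  have len: "length (a @ b) = n" "length (b @ c) = n"
    unfolding ab[symmetric] bc[symmetric] using length_omit i j by simp_all
  have "length (a @ b @ c) \<le> n + 1"
    using card_mono[OF _ sub] distinct_card[OF dist] by simp
  then have "length a = 1" "length c = 1"
    using len nonempty by (auto simp: Suc_le_eq neq_Nil_conv)
  then obtain x y where xy: "a = [x]" "c = [y]"
    by (auto simp: length_Suc_conv)
  then have "card (set (a @ b @ c)) = n + 1"
    using len distinct_card[OF dist] by simp
  then have all: "set (a @ b @ c) = {1..n + 1}"
    using sub by (simp add: card_subset_eq)
  then have rev: "rev (a @ b @ c) = [1..<n + 2]"
    by (intro strict_sorted_equal[OF W, symmetric]) (simp_all only: sorted_wrt_upt set_rev set_upt all, auto)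
  then show "a @ b @ c = rev [1..<n + 2]"
    by (metis rev_rev_ident)
  from rev have "y # rev b @ [x] = [1..<n + 2]" by (simp add: xy)
  moreover have "hd [1..<n + 2] = 1" "last [1..<n + 2] = n + 1" by (simp_all del: upt_Suc)
  ultimately have "y = 1" "x = n + 1"
    by (metis list.sel(1), metis last_snoc append_Cons)
  then show a: "a = [n + 1]" and c: "c = [1]" using xy by simp_all
  have "set (a @ b) = {1..n + 1} - {1}" "set (b @ c) = {1..n + 1} - {n + 1}"
    using all dist a c by auto
  then have "set (omit n i) = set (omit n 1)" and "set (omit n j) = set (omit n (n + 1))"
    using set_ab set_bc by (simp_all only: set_omit)
  then show "i = 1" and "j = n + 1"
    using set_omit_inj i j by blast+
qed

text \<open>
  The two expansions of \<open>alt(x\<^sub>1, \<dots>, x\<^sub>n\<^sub>+\<^sub>1)\<close>, along the first and along the last factor, have the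
  signs \<open>(-1)\<^sup>j\<close> and \<open>(-1)\<^sup>n\<^sup>+\<^sup>j\<close>. These agree for even \<open>n\<close>. Replacing each alternating sum by the
  relation changes both sides by the same multiples of \<open>x\<^sub>i x\<^sub>i\<close>.
\<close>

lemma alt_relation_syzygy:
  assumes "even n"
  shows "(\<Sum>i = 1..n + 1. (-1) ^ i * (gen i * alt_relation n i)) =
    (\<Sum>i = 1..n + 1. (-1) ^ i * (alt_relation n i * (gen i :: 'f::field noncomm_poly)))"
proof -
  let ?zs = "map gen [1..<n + 2] :: 'f noncomm_poly list"
  let ?alt = "\<lambda>i. alt (map gen (omit n i)) :: 'f noncomm_poly"
  have len: "length ?zs = Suc n" by simp
  have nth: "?zs ! j = gen (Suc j)" and del: "delete_nth j ?zs = map gen (omit n (Suc j))" if "j < Suc n" for j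
  proof -
    show "?zs ! j = gen (Suc j)" using that by (simp del: upt_Suc)
    show "delete_nth j ?zs = map gen (omit n (Suc j))"
      using that unfolding delete_nth_map by (simp add: delete_nth_def omit_eq del: upt_Suc)
  qed
  have "alt ?zs = (\<Sum>j<Suc n. (-1) ^ j * (gen (Suc j) * ?alt (Suc j)))"
    unfolding alt_expand_first[OF len] by (intro sum.cong refl) (simp only: nth del lessThan_iff)
  moreover have "alt ?zs = (\<Sum>j<Suc n. (-1) ^ (n + j) * (?alt (Suc j) * gen (Suc j)))"
    unfolding alt_expand_last[OF len] by (intro sum.cong refl) (simp only: nth del lessThan_iff)
  ultimately have alt: "(\<Sum>j<Suc n. (-1) ^ Suc j * (gen (Suc j) * ?alt (Suc j) - ?alt (Suc j) * gen (Suc j))) = 0"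
    using assms by (simp add: sum_negf right_diff_distrib sum_subtractf power_add del: sum.lessThan_Suc upt_Suc)
  have rel: "gen i * alt_relation n i - alt_relation n i * gen i =
      (-1) ^ (n div 2) * (gen i * ?alt i - ?alt i * gen i)" for i
    unfolding alt_relation_def
    by (cases "even (n div 2)"; cases "even (n + i + 1)") (simp_all add: algebra_simps)
  have "(\<Sum>i = 1..n + 1. (-1) ^ i * (gen i * alt_relation n i)) -
      (\<Sum>i = 1..n + 1. (-1) ^ i * (alt_relation n i * (gen i :: 'f noncomm_poly))) =
      (\<Sum>i = 1..n + 1. (-1) ^ i * ((-1) ^ (n div 2) * (gen i * ?alt i - ?alt i * gen i)))"
    by (simp only: rel flip: sum_subtractf right_diff_distrib)
  also have "\<dots> = (-1) ^ (n div 2) * (\<Sum>i = 1..n + 1. (-1) ^ i * (gen i * ?alt i - ?alt i * gen i))"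
    unfolding sum_distrib_left
  proof (rule sum.cong[OF refl])
    fix i
    show "(-1) ^ i * ((-1) ^ (n div 2) * (gen i * ?alt i - ?alt i * gen i)) =
        (-1) ^ (n div 2) * ((-1) ^ i * (gen i * ?alt i - ?alt i * gen i))"
      by (cases "even (n div 2)"; cases "even i") simp_all
  qed
  also have "\<dots> = 0"
  proof -
    have "sum f {1..n + 1} = (\<Sum>j<Suc n. f (Suc j))" for f :: "nat \<Rightarrow> 'f noncomm_poly"
      by (simp only: One_nat_def sum.atLeast1_atMost_eq add_Suc_right add_0_right)
    then show ?thesis by (simp only: alt mult_zero_right)
  qed
  finally show ?thesis by simp
qed

lemma alt_relation_tail:
  assumes n: "n \<ge> 2" and i: "i \<in> {1..n + 1}"
  shows "monomial (rev (omit n i)) - alt_relation n i \<in>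
    words.span (monomial ` {m \<in> lists {1..n + 1}. m \<lless> rev (omit n i)} :: 'f::field noncomm_poly set)"
    (is "_ \<in> ?S")
proof -
  have "monomial (rev (omit n i)) - (-1) ^ (n div 2) * alt (map gen (omit n i)) \<in>
      (words.span (monomial ` {m \<in> lists (set (omit n i)). m \<lless> rev (omit n i)}) :: 'f noncomm_poly set)"
    using leading_word_alt[OF sorted_omit[of n i]] unfolding length_omit[OF i] .
  also have "\<dots> \<subseteq> ?S"
    by (intro words.span_mono image_mono) (auto simp: set_omit)
  finally have lead: "monomial (rev (omit n i)) - (-1) ^ (n div 2) * alt (map gen (omit n i)) \<in> ?S" .
  have "gen i \<in> ?S"
    using n i length_omit[OF i] by (intro words.span_base imageI) (auto simp: lenlex_conv)
  then have "(monomial (rev (omit n i)) - (-1) ^ (n div 2) * alt (map gen (omit n i))) +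
      (-1) ^ (n div 2) * ((-1) ^ (n + i + 1) * gen i) \<in> ?S"
    by (intro words.span_add[OF lead] span_sign_mult)
  then show ?thesis
    by (simp add: alt_relation_def algebra_simps)
qed

lemma monic_alt_relations:
  assumes "n \<ge> 2"
  shows "monic_relations {1..n + 1} {1..n + 1} (\<lambda>i. rev (omit n i)) (alt_relation n :: nat \<Rightarrow> 'f::field noncomm_poly)"
  using alt_relation_tail[OF assms] by unfold_locales (auto simp: set_omit)

text \<open>
  The composition consists of the term with \<open>i = 1\<close> and the term with \<open>i = n + 1\<close> on the two sides of
  the syzygy. In the remaining terms, \<open>x\<^sub>i D\<^sub>i\<close> with \<open>i \<le> n\<close> has a smaller first letter than
  \<open>x\<^sub>n\<^sub>+\<^sub>1 \<cdots> x\<^sub>1\<close>, and \<open>D\<^sub>i x\<^sub>i\<close> with \<open>i \<ge> 2\<close> first differs from it where \<open>x\<^sub>i\<close> is replaced by \<open>x\<^sub>i\<^sub>-\<^sub>1\<close>.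
\<close>

lemma overlap_resolvable:
  assumes n: "n \<ge> 2" "even n"
  shows "alt_relation n 1 * gen 1 - gen (n + 1) * (alt_relation n (n + 1) :: 'f::field noncomm_poly) \<in>
    words.span (monic_relations.multiples {1..n + 1} {1..n + 1} (\<lambda>i. rev (omit n i)) (alt_relation n)
      (\<lambda>w. w \<lless> rev [1..<n + 2]))" (is "_ \<in> ?S")
proof -
  interpret monic_relations "{1..n + 1}" "{1..n + 1}" "\<lambda>i. rev (omit n i)" "alt_relation n :: nat \<Rightarrow> 'f noncomm_poly"
    by (rule monic_alt_relations[OF n(1)])
  have word: "rev [1..<n + 2] = rev [Suc i..<n + 2] @ i # rev [1..<i]" if "i \<in> {1..n + 1}" for i
    unfolding upt_split_at[OF that] by (simp del: upt_Suc)
  have left: "gen i * alt_relation n i \<in> ?S" if i: "i \<in> {1..n}" for i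
  proof -
    have "[i] @ rev (omit n i) @ [] \<lless> rev [1..<n + 2]"
      using i word[of "n + 1"] length_omit[of i n] by (simp add: deglex_head del: upt_Suc)
    then have "monomial [i] * alt_relation n i * monomial [] \<in> multiples (\<lambda>w. w \<lless> rev [1..<n + 2])"
      using i by (intro multiplesI) auto
    then show ?thesis by (simp add: monomial_Nil words.span_base)
  qed
  have right: "alt_relation n i * gen i \<in> ?S" if i: "i \<in> {2..n + 1}" for i
  proof -
    have "rev [1..<i] = (i - 1) # rev [1..<i - 1]"
      using i by (cases i) auto
    moreover have "(i - 1) # rev [1..<i - 1] @ [i] \<lless> i # (i - 1) # rev [1..<i - 1]"
      using i by (intro deglex_head) auto
    ultimately have "rev [1..<i] @ [i] \<lless> i # rev [1..<i]"
      by simp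
    then have "[] @ rev (omit n i) @ [i] \<lless> rev [1..<n + 2]"
      using i word[of i] lenlex_append2[OF irrefl_less_than] by (simp add: omit_eq del: upt_Suc)
    then have "monomial [] * alt_relation n i * monomial [i] \<in> multiples (\<lambda>w. w \<lless> rev [1..<n + 2])"
      using i by (intro multiplesI) auto
    then show ?thesis by (simp add: monomial_Nil words.span_base)
  qed
  have "alt_relation n 1 * gen 1 - gen (n + 1) * (alt_relation n (n + 1) :: 'f noncomm_poly) =
      (\<Sum>i = 2..n + 1. (-1) ^ i * (alt_relation n i * gen i)) - (\<Sum>i = 1..n. (-1) ^ i * (gen i * alt_relation n i))"
    using alt_relation_syzygy[OF n(2), where 'f='f] n
      sum.atLeast_Suc_atMost[of 1 "n + 1" "\<lambda>i. (-1) ^ i * (alt_relation n i * (gen i :: 'f noncomm_poly))"]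
    by (simp add: numeral_2_eq_2 algebra_simps)
  also have "\<dots> \<in> ?S"
    by (intro words.span_diff words.span_sum span_sign_mult left right)
  finally show ?thesis .
qed

theorem groebner_basis_alt_relations:
  assumes n: "n \<ge> 2" "even n"
  shows "groebner_basis {1..n + 1} {1..n + 1} (\<lambda>i. rev (omit n i)) (alt_relation n :: nat \<Rightarrow> 'f::field noncomm_poly)"
proof -
  interpret monic_relations "{1..n + 1}" "{1..n + 1}" "\<lambda>i. rev (omit n i)" "alt_relation n :: nat \<Rightarrow> 'f noncomm_poly"
    by (rule monic_alt_relations[OF n(1)])
  show ?thesis
  proof unfold_locales
    fix i j u v assume ij: "i \<in> {1..n + 1}" "j \<in> {1..n + 1}" "rev (omit n i) = u @ rev (omit n j) @ v"
    from arg_cong[OF ij(3), of length] have uv: "u = []" "v = []"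
      using ij(1,2) length_omit by auto
    then have "set (omit n i) = set (omit n j)"
      using ij(3) by simp
    then show "i = j \<and> u = [] \<and> v = []"
      using uv set_omit_inj[OF ij(1)] by blast
  next
    fix i j a b c
    assume ij: "i \<in> {1..n + 1}" "j \<in> {1..n + 1}" "rev (omit n i) = a @ b" "rev (omit n j) = b @ c"
      "a \<noteq> []" "b \<noteq> []" "c \<noteq> []"
    note overlap = overlap_of_leading_words[OF ij]
    show "alt_relation n i * monomial c - monomial a * alt_relation n j \<in> relations_below (a @ b @ c)"
      unfolding overlap(5) unfolding overlap(1-4) by (rule overlap_resolvable[OF n])
  qed
qed

lemma normal_words_eq:
  assumes n: "n \<ge> 2"
  shows "normal_words n = lists {1..n + 1} -
    monic_relations.reducible {1..n + 1} {1..n + 1} (\<lambda>i. rev (omit n i))"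
proof -
  \<comment> \<open>Reducibility is a property of the leading words, which are the same over every field.\<close>
  interpret monic_relations "{1..n + 1}" "{1..n + 1}" "\<lambda>i. rev (omit n i)" "alt_relation n :: nat \<Rightarrow> rat noncomm_poly"
    by (rule monic_alt_relations[OF n])
  have "(\<exists>u. sublist u w \<and> length u = n \<and> sorted_wrt (>) u) \<longleftrightarrow> w \<in> reducible"
    if w: "w \<in> lists {1..n + 1}" for w
  proof
    assume "\<exists>u. sublist u w \<and> length u = n \<and> sorted_wrt (>) u"
    then obtain u p s where u: "w = p @ u @ s" "length u = n" "sorted_wrt (>) u"
      by (auto simp: sublist_def)
    then obtain i where "i \<in> {1..n + 1}" "u = rev (omit n i)"
      using decreasing_word_eq[of u n] w by auto
    then show "w \<in> reducible"
      using u(1) w unfolding reducible_def by auto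
  next
    assume "w \<in> reducible"
    then obtain u i v where "w = u @ rev (omit n i) @ v" "i \<in> {1..n + 1}"
      unfolding reducible_def by blast
    then show "\<exists>u. sublist u w \<and> length u = n \<and> sorted_wrt (>) u"
      using length_omit sorted_omit by (intro exI[of _ "rev (omit n i)"]) (auto simp: sorted_wrt_rev)
  qed
  then show ?thesis
    unfolding normal_words_def by auto
qed

lemma infinite_normal_words:
  assumes "n \<ge> 2"
  shows "infinite (normal_words n)"
proof -
  have "replicate k 1 \<in> normal_words n" for k
  proof -
    have False if u: "sublist u (replicate k (1::nat))" "length u = n" "sorted_wrt (>) u" for u
    proof -
      have "set u \<subseteq> {1}"
        using set_mono_sublist[OF u(1)] by auto
      moreover have "0 < length u" "1 < length u" using u(2) assms by auto
      ultimately have "u ! 0 = 1" "u ! 1 = 1"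
        using nth_mem by (metis singletonD subsetD)+
      then show False
        using sorted_wrt_nth_less[OF u(3), of 0 1] \<open>1 < length u\<close> by simp
    qed
    then show ?thesis
      by (auto simp: normal_words_def)
  qed
  moreover have "inj (\<lambda>k. replicate k (1::nat))"
    by (auto intro: injI dest: arg_cong[where f = length])
  ultimately show ?thesis
    by (meson finite_subset image_subsetI range_inj_infinite)
qed

theorem corollary4p2:
  fixes scale :: "'f::field \<Rightarrow> 'v::ab_group_add \<Rightarrow> 'v"
    and n :: nat and br :: "'v list \<Rightarrow> 'v" and e :: "nat \<Rightarrow> 'v"
  assumes "n \<ge> 4" and "even n" and "CHAR('f) \<noteq> 2"
    and "n_Lie_algebra scale n br"
    and "n_Lie_algebra.simple scale n br"
    and "n_Lie_algebra.ordered_basis scale (n + 1) e"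
    and "\<And>i. i \<in> {1..n + 1} \<Longrightarrow> br (map e (omit n i)) = scale ((- 1) ^ (n + i + 1)) (e i)"
  defines "U \<equiv> n_Lie_algebra.envelope scale n br e"
    and "K \<equiv> n_Lie_algebra.env_scalars scale n br e"
    and "coset \<equiv> n_Lie_algebra.env_coset scale n br e"
  shows "\<not> ring.finite_dimension U K (carrier U) \<and>
    inj_on (\<lambda>w. coset (monomial w)) (normal_words n) \<and>
    is_basis U K ((\<lambda>w. coset (monomial w)) ` normal_words n)"
proof -
  have n: "n \<ge> 2" using assms(1) by simp
  interpret L: n_Lie_algebra scale n br by (rule assms(4))
  interpret G: groebner_basis "{1..n + 1}" "{1..n + 1}" "\<lambda>i. rev (omit n i)" "alt_relation n :: nat \<Rightarrow> 'f noncomm_poly"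
    by (rule groebner_basis_alt_relations[OF n assms(2)])
  have "L.env_relation e i = alt_relation n i" if "i \<in> {1..n + 1}" for i
    unfolding alt_relation_def using L.env_relation_eq[OF assms(6) that assms(7)[OF that]] .
  then have ideal: "L.env_ideal e = genideal (free_algebra {1..n + 1}) (alt_relation n ` {1..n + 1})"
    unfolding L.env_ideal_def by (intro arg_cong[where f = "genideal _"] image_cong refl)
  have U: "U = G.quotient" and K: "K = G.scalars" and coset: "coset = G.coset"
    unfolding U_def K_def coset_def L.envelope_def L.env_scalars_def L.env_coset_def ideal by simp_all
  show ?thesis
    unfolding U K coset normal_words_eq[OF n]
    using G.infinite_dimension_quotient G.inj_on_coset_monomial G.is_basis_normal_words
      infinite_normal_words[OF n] normal_words_eq[OF n] by simp
qed

end
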